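(* Let $\Gamma$ be a tropical curve with a forbidden pattern which is a TIE-fighter graph. Then $\Gamma$ does not admit a degree $3$ well-contracted cover, up to tropical modifications; that is, no tropical modification of $\Gamma$ (including $\Gamma$ itself) admits a well-contracted cover of degree $3$.
   Context: **Pattern.** A tropical curve is a connected metric graph $\Gamma$ (with a genus function on points); the pattern refers to its canonical model (obtained by shrinking unbounded ends and, iteratively, leaf edges). $\Gamma$ is a TIE-fighter graph if it consists of two 3-valent vertices $a,b$, four pairwise disjoint connected subgraphs $\Gamma_1,\Gamma_2,\Gamma_3,\Gamma_4$ of positive genus (each contains a cycle) not containing $a,b$, and the following edges, with no further edges: $e_1$ joining a vertex of $\Gamma_1$ to $a$; $e_2$ and $e_3$ joining $a$ to a vertex of $\Gamma_2$ and of $\Gamma_3$ respectively; $e_2'$ and $e_3'$ joining a vertex of $\Gamma_2$ and of $\Gamma_3$ respectively to $b$; $e_4$ joining $b$ to a vertex of $\Gamma_4$. **Modifications.** A tropical modification of $\Gamma$ is a metric graph with the same canonical model obtained by gluing trees (possibly with unbounded edges) to $\Gamma$ at some points. **Covers.** A model of a metric graph is a pair $(G,l)$, a graph with edge lengths; models may be refined by adding 2-valent vertices. A continuous map $\varphi:\Gamma_1\to\Gamma_2$ of metric graphs is a morphism if for suitable models $(G_1,l_1),(G_2,l_2)$ one has $\varphi(V(G_1))\subset V(G_2)$, $\varphi^{-1}(E(G_2))\subset E(G_1)$, and for each $e\in E(G_1)$ the number $\mu_\varphi(e)$, defined as $l_2(\varphi(e))/l_1(e)$ if $\varphi(e)$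 is an edge and as $0$ if $\varphi(e)$ is a vertex ($e$ is contracted), is a nonnegative integer, positive in the first case (for unbounded edges $\mu_\varphi(e)$ is the slope). It is non-degenerate if every vertex $v$ has an incident edge $e$ with $\mu_\varphi(e)>0$ and no loop is contracted. It is harmonic if for each vertex $v$ the number $m_\varphi(v)=\sum_{e\ni v,\ \varphi(e)=e'}\mu_\varphi(e)$ does not depend on the edge $e'$ at $\varphi(v)$; its degree is $\sum_{\varphi(e)=e'}\mu_\varphi(e)$, independent of the edge $e'$ of the target. A tropical cover of degree $d$ is a harmonic morphism of degree $d$ such that for every vertex $v$ whose image has valence at least $2$, $(2m_\varphi(v)-2)-\sum_{e\ni v}(\mu_\varphi(e)-1)\ge 0$ (sum over all outgoing edges at $v$, contracted ones included). A path is a metric tree homeomorphic to an interval (possibly unbounded). A well-contracted cover is a non-degenerate tropical cover whose target is a path. *)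

theory Defs
  imports "HOL-Library.Multiset" "HOL-Library.Extended_Real"
begin

text \<open>
  A metric graph is given by a model, that is, a finite multigraph with edge lengths; loops and
  parallel edges are allowed. An edge has a multiset of endpoints: a bounded edge has two of them
  (a loop at \<open>v\<close> has \<open>{#v, v#}\<close>), an unbounded edge has length \<open>\<infinity>\<close> and a single endpoint (there are
  no vertices at infinity). Two models describe the same metric graph iff they have a common
  refinement, see \<open>same_metric_graph\<close> below.
\<close>

record ('v, 'e) metric_graph =
  verts :: "'v set"
  edges :: "'e set"
  endpoints :: "'e \<Rightarrow> 'v multiset"
  edge_length :: "'e \<Rightarrow> ereal"

text \<open>The genus function on points has finite support, so its support may be taken to consist of
  vertices of the model.\<close>

record ('v, 'e) tropical_curve = "('v, 'e) metric_graph" +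
  genus :: "'v \<Rightarrow> nat"

definition metric_graph :: "('v, 'e, 'm) metric_graph_scheme \<Rightarrow> bool" where
  "metric_graph G \<longleftrightarrow>
     finite (verts G) \<and> finite (edges G) \<and> verts G \<noteq> {} \<and>
     (\<forall>e\<in>edges G. set_mset (endpoints G e) \<subseteq> verts G \<and> 0 < edge_length G e \<and>
        size (endpoints G e) = (if edge_length G e = \<infinity> then 1 else 2))"

definition connected_graph :: "('v, 'e, 'm) metric_graph_scheme \<Rightarrow> bool" where
  "connected_graph G \<longleftrightarrow>
     (\<forall>u\<in>verts G. \<forall>v\<in>verts G. (u, v) \<in> {(x, y). \<exists>e\<in>edges G. endpoints G e = {#x, y#}}\<^sup>*)"

definition tropical_curve :: "('v, 'e) tropical_curve \<Rightarrow> bool" where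
  "tropical_curve G \<longleftrightarrow> metric_graph G \<and> connected_graph G"

text \<open>Number of outgoing edges at \<open>v\<close>; loops count twice, unbounded edges count once.\<close>

definition valence :: "('v, 'e, 'm) metric_graph_scheme \<Rightarrow> 'v \<Rightarrow> nat" where
  "valence G v = (\<Sum>e\<in>edges G. count (endpoints G e) v)"

text \<open>A cycle runs through distinct vertices and distinct edges; a loop is a cycle of length one
  and a pair of parallel edges is a cycle of length two.\<close>

definition is_cycle ::
    "('v, 'e, 'm) metric_graph_scheme \<Rightarrow> 'v list \<Rightarrow> 'e list \<Rightarrow> bool" where
  "is_cycle G vs es \<longleftrightarrow>
     es \<noteq> [] \<and> length vs = length es \<and> distinct vs \<and> distinct es \<and> set es \<subseteq> edges G \<and>
     (\<forall>i<length es. endpoints G (es ! i) = {#vs ! i, vs ! (Suc i mod length es)#})"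

definition has_cycle :: "('v, 'e, 'm) metric_graph_scheme \<Rightarrow> bool" where
  "has_cycle G \<longleftrightarrow> (\<exists>vs es. is_cycle G vs es)"

definition metric_tree :: "('v, 'e, 'm) metric_graph_scheme \<Rightarrow> bool" where
  "metric_tree G \<longleftrightarrow> metric_graph G \<and> connected_graph G \<and> \<not> has_cycle G"

text \<open>A metric tree is homeomorphic to an interval iff no point has more than two directions.\<close>

definition path_graph :: "('v, 'e, 'm) metric_graph_scheme \<Rightarrow> bool" where
  "path_graph G \<longleftrightarrow> metric_tree G \<and> (\<forall>v\<in>verts G. valence G v \<le> 2)"

definition subgraph ::
    "('v, 'e, 'm) metric_graph_scheme \<Rightarrow> ('v, 'e, 'n) metric_graph_scheme \<Rightarrow> bool" where
  "subgraph H G \<longleftrightarrow>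
     metric_graph H \<and> verts H \<subseteq> verts G \<and> edges H \<subseteq> edges G \<and>
     (\<forall>e\<in>edges H. endpoints H e = endpoints G e \<and> edge_length H e = edge_length G e)"


subsection \<open>Models of the same metric graph\<close>

definition isomorphic_models ::
    "('v, 'e, 'm) metric_graph_scheme \<Rightarrow> ('w, 'f, 'n) metric_graph_scheme \<Rightarrow> bool" where
  "isomorphic_models G H \<longleftrightarrow>
     (\<exists>f g. bij_betw f (verts G) (verts H) \<and> bij_betw g (edges G) (edges H) \<and>
        (\<forall>e\<in>edges G. endpoints H (g e) = image_mset f (endpoints G e) \<and>
                      edge_length H (g e) = edge_length G e))"

text \<open>
  \<open>subdivision G H\<close>: one new 2-valent vertex \<open>w\<close> is inserted into an edge \<open>e\<close>, whose endpoints are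
  \<open>u\<close> and those in \<open>M\<close> (at most one). The piece \<open>e1\<close> is bounded; \<open>e2\<close> is unbounded iff \<open>e\<close> is.
  One of the two pieces may keep the name \<open>e\<close>.
\<close>

definition subdivision :: "('v, 'e) metric_graph \<Rightarrow> ('v, 'e) metric_graph \<Rightarrow> bool" where
  "subdivision G H \<longleftrightarrow>
     (\<exists>e e1 e2 u w M.
        e \<in> edges G \<and> endpoints G e = add_mset u M \<and> w \<notin> verts G \<and>
        e1 \<noteq> e2 \<and> e1 \<notin> edges G - {e} \<and> e2 \<notin> edges G - {e} \<and>
        verts H = insert w (verts G) \<and> edges H = (edges G - {e}) \<union> {e1, e2} \<and>
        endpoints H e1 = {#u, w#} \<and> endpoints H e2 = add_mset w M \<and>
        0 < edge_length H e1 \<and> edge_length H e1 < \<infinity> \<and> 0 < edge_length H e2 \<and>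
        edge_length G e = edge_length H e1 + edge_length H e2 \<and>
        (\<forall>f\<in>edges G - {e}. endpoints H f = endpoints G f \<and> edge_length H f = edge_length G f))"

definition refinement ::
    "('w, 'f) metric_graph \<Rightarrow> ('v, 'e, 'm) metric_graph_scheme \<Rightarrow> bool" where
  "refinement R G \<longleftrightarrow>
     metric_graph G \<and> (\<exists>G0. isomorphic_models G G0 \<and> subdivision\<^sup>*\<^sup>* G0 R)"

text \<open>Models are finite, so taking vertices and edges of the common refinement to be natural
  numbers is no restriction.\<close>

definition same_metric_graph ::
    "('v, 'e, 'm) metric_graph_scheme \<Rightarrow> ('w, 'f, 'n) metric_graph_scheme \<Rightarrow> bool" where
  "same_metric_graph G H \<longleftrightarrow>
     (\<exists>R :: (nat, nat) metric_graph. refinement R G \<and> refinement R H)"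


subsection \<open>Canonical models and tropical modifications\<close>

inductive shrink_step ::
    "('v, 'e, 'm) metric_graph_scheme \<Rightarrow> ('v, 'e, 'm) metric_graph_scheme \<Rightarrow> bool" where
  unbounded_end: "e \<in> edges G \<Longrightarrow> edge_length G e = \<infinity> \<Longrightarrow>
    shrink_step G (G\<lparr>edges := edges G - {e}\<rparr>)"
| leaf_edge: "v \<in> verts G \<Longrightarrow> valence G v = 1 \<Longrightarrow>
    e \<in> edges G \<Longrightarrow> v \<in># endpoints G e \<Longrightarrow> edge_length G e < \<infinity> \<Longrightarrow>
    shrink_step G (G\<lparr>verts := verts G - {v}, edges := edges G - {e}\<rparr>)"

text \<open>The vertices of \<open>C\<close> that become 2-valent are kept: the result is meant up to
  \<open>same_metric_graph\<close>.\<close>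

definition canonical_model ::
    "('v, 'e, 'm) metric_graph_scheme \<Rightarrow> ('v, 'e, 'm) metric_graph_scheme \<Rightarrow> bool" where
  "canonical_model G C \<longleftrightarrow> shrink_step\<^sup>*\<^sup>* G C \<and> (\<nexists>D. shrink_step C D)"

text \<open>\<open>glue_tree H G\<close>: \<open>G\<close> arises from \<open>H\<close> by gluing one tree at one vertex.\<close>

definition glue_tree :: "('v, 'e) metric_graph \<Rightarrow> ('v, 'e) metric_graph \<Rightarrow> bool" where
  "glue_tree H G \<longleftrightarrow>
     metric_graph G \<and> subgraph H G \<and>
     (\<exists>(T :: ('v, 'e) metric_graph) p. subgraph T G \<and> metric_tree T \<and>
        verts G = verts H \<union> verts T \<and> verts H \<inter> verts T = {p} \<and>
        edges G = edges H \<union> edges T \<and> edges H \<inter> edges T = {})"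

text \<open>Trees may be glued at arbitrary points, since \<open>H\<close> is any model of the metric graph \<open>G\<close>.
  Gluing no tree at all is included.\<close>

definition tropical_modification ::
    "('w, 'f) metric_graph \<Rightarrow> ('v, 'e, 'm) metric_graph_scheme \<Rightarrow> bool" where
  "tropical_modification G' G \<longleftrightarrow>
     (\<exists>H. same_metric_graph H G \<and> glue_tree\<^sup>*\<^sup>* H G') \<and>
     (\<exists>C' C. canonical_model G' C' \<and> canonical_model G C \<and> same_metric_graph C' C)"


subsection \<open>TIE-fighter graphs\<close>

definition joins_to ::
    "('v, 'e, 'm) metric_graph_scheme \<Rightarrow> 'e \<Rightarrow> ('v, 'e, 'n) metric_graph_scheme \<Rightarrow> 'v \<Rightarrow> bool" where
  "joins_to G e S v \<longleftrightarrow> e \<in> edges G \<and> (\<exists>s\<in>verts S. endpoints G e = {#s, v#})"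

text \<open>
  The choice of the model is immaterial: 2-valent vertices on one of the six joining edges can be
  absorbed into the subgraph \<open>S i\<close> at the end of that edge.
\<close>

definition tie_fighter :: "('v, 'e, 'm) metric_graph_scheme \<Rightarrow> bool" where
  "tie_fighter G \<longleftrightarrow>
     (\<exists>a b e1 e2 e3 e2' e3' e4 (S :: nat \<Rightarrow> ('v, 'e) metric_graph).
        a \<in> verts G \<and> b \<in> verts G \<and> a \<noteq> b \<and> valence G a = 3 \<and> valence G b = 3 \<and>
        (\<forall>i\<in>{1..4}. subgraph (S i) G \<and> connected_graph (S i) \<and> has_cycle (S i) \<and>
                    a \<notin> verts (S i) \<and> b \<notin> verts (S i)) \<and>
        (\<forall>i\<in>{1..4}. \<forall>j\<in>{1..4}. i \<noteq> j \<longrightarrow> verts (S i) \<inter> verts (S j) = {}) \<and>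
        joins_to G e1 (S 1) a \<and> joins_to G e2 (S 2) a \<and> joins_to G e3 (S 3) a \<and>
        joins_to G e2' (S 2) b \<and> joins_to G e3' (S 3) b \<and> joins_to G e4 (S 4) b \<and>
        verts G = {a, b} \<union> (\<Union>i\<in>{1..4}. verts (S i)) \<and>
        edges G = {e1, e2, e3, e2', e3', e4} \<union> (\<Union>i\<in>{1..4}. edges (S i)))"


subsection \<open>Covers\<close>

text \<open>
  A morphism between models sends each edge either to an edge (\<open>Inr\<close>) or to a vertex (\<open>Inl\<close>, a
  contracted edge). The integer \<open>slope \<phi> e\<close> is \<open>\<mu>\<^sub>\<phi>(e)\<close>; on unbounded edges it is additional data.
\<close>

record ('v, 'e, 'w, 'f) graph_map =
  vmap :: "'v \<Rightarrow> 'w"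
  emap :: "'e \<Rightarrow> 'w + 'f"
  slope :: "'e \<Rightarrow> nat"

text \<open>
  The target model is taken without loops, which subdivision always achieves. Thus an edge \<open>e'\<close> at
  \<open>v'\<close> is the same as a direction at \<open>v'\<close>, and the two ends of a non-contracted edge have different
  images.
\<close>

definition graph_morphism ::
    "('v, 'e, 'm) metric_graph_scheme \<Rightarrow> ('w, 'f, 'n) metric_graph_scheme \<Rightarrow>
     ('v, 'e, 'w, 'f) graph_map \<Rightarrow> bool" where
  "graph_morphism G G' \<phi> \<longleftrightarrow>
     metric_graph G \<and> metric_graph G' \<and>
     (\<forall>e'\<in>edges G'. \<nexists>v'. endpoints G' e' = {#v', v'#}) \<and>
     (\<forall>v\<in>verts G. vmap \<phi> v \<in> verts G') \<and>
     (\<forall>e\<in>edges G. case emap \<phi> e of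
        Inl v' \<Rightarrow> v' \<in> verts G' \<and> (\<forall>v\<in>#endpoints G e. vmap \<phi> v = v') \<and> slope \<phi> e = 0
      | Inr e' \<Rightarrow> e' \<in> edges G' \<and> endpoints G' e' = image_mset (vmap \<phi>) (endpoints G e) \<and>
                  0 < slope \<phi> e \<and>
                  edge_length G' e' = ereal (real (slope \<phi> e)) * edge_length G e)"

definition non_degenerate ::
    "('v, 'e, 'm) metric_graph_scheme \<Rightarrow> ('v, 'e, 'w, 'f) graph_map \<Rightarrow> bool" where
  "non_degenerate G \<phi> \<longleftrightarrow>
     (\<forall>v\<in>verts G. \<exists>e\<in>edges G. v \<in># endpoints G e \<and> 0 < slope \<phi> e) \<and>
     (\<forall>e\<in>edges G. (\<exists>v. endpoints G e = {#v, v#}) \<longrightarrow> (\<nexists>v'. emap \<phi> e = Inl v'))"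

definition slope_sum ::
    "('v, 'e, 'm) metric_graph_scheme \<Rightarrow> ('v, 'e, 'w, 'f) graph_map \<Rightarrow> 'v \<Rightarrow> 'f \<Rightarrow> nat" where
  "slope_sum G \<phi> v e' = (\<Sum>e \<in> {e \<in> edges G. v \<in># endpoints G e \<and> emap \<phi> e = Inr e'}. slope \<phi> e)"

definition harmonic ::
    "('v, 'e, 'm) metric_graph_scheme \<Rightarrow> ('w, 'f, 'n) metric_graph_scheme \<Rightarrow>
     ('v, 'e, 'w, 'f) graph_map \<Rightarrow> bool" where
  "harmonic G G' \<phi> \<longleftrightarrow>
     (\<forall>v\<in>verts G. \<forall>e'\<in>edges G'. \<forall>f'\<in>edges G'.
        vmap \<phi> v \<in># endpoints G' e' \<and> vmap \<phi> v \<in># endpoints G' f' \<longrightarrow>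
        slope_sum G \<phi> v e' = slope_sum G \<phi> v f')"

text \<open>The number \<open>m\<^sub>\<phi>(v)\<close>; for harmonic \<open>\<phi>\<close> the choice of \<open>e'\<close> is irrelevant.\<close>

definition local_degree ::
    "('v, 'e, 'm) metric_graph_scheme \<Rightarrow> ('w, 'f, 'n) metric_graph_scheme \<Rightarrow>
     ('v, 'e, 'w, 'f) graph_map \<Rightarrow> 'v \<Rightarrow> nat" where
  "local_degree G G' \<phi> v =
     slope_sum G \<phi> v (SOME e'. e' \<in> edges G' \<and> vmap \<phi> v \<in># endpoints G' e')"

definition has_degree ::
    "('v, 'e, 'm) metric_graph_scheme \<Rightarrow> ('w, 'f, 'n) metric_graph_scheme \<Rightarrow>
     ('v, 'e, 'w, 'f) graph_map \<Rightarrow> nat \<Rightarrow> bool" where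
  "has_degree G G' \<phi> d \<longleftrightarrow>
     (\<forall>e'\<in>edges G'. (\<Sum>e \<in> {e \<in> edges G. emap \<phi> e = Inr e'}. slope \<phi> e) = d)"

definition tropical_cover ::
    "('v, 'e, 'm) metric_graph_scheme \<Rightarrow> ('w, 'f, 'n) metric_graph_scheme \<Rightarrow>
     ('v, 'e, 'w, 'f) graph_map \<Rightarrow> nat \<Rightarrow> bool" where
  "tropical_cover G G' \<phi> d \<longleftrightarrow>
     graph_morphism G G' \<phi> \<and> harmonic G G' \<phi> \<and> has_degree G G' \<phi> d \<and>
     (\<forall>v\<in>verts G. 2 \<le> valence G' (vmap \<phi> v) \<longrightarrow>
        0 \<le> (2 * int (local_degree G G' \<phi> v) - 2)
             - (\<Sum>e\<in>edges G. int (count (endpoints G e) v) * (int (slope \<phi> e) - 1)))"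

definition well_contracted_cover ::
    "('v, 'e, 'm) metric_graph_scheme \<Rightarrow> ('w, 'f, 'n) metric_graph_scheme \<Rightarrow>
     ('v, 'e, 'w, 'f) graph_map \<Rightarrow> nat \<Rightarrow> bool" where
  "well_contracted_cover G T \<phi> d \<longleftrightarrow>
     tropical_cover G T \<phi> d \<and> non_degenerate G \<phi> \<and> path_graph T"

text \<open>The models of source and target are arbitrary; as they are finite, labelling them by natural
  numbers is no restriction.\<close>

definition admits_well_contracted_cover ::
    "('v, 'e, 'm) metric_graph_scheme \<Rightarrow> nat \<Rightarrow> bool" where
  "admits_well_contracted_cover G d \<longleftrightarrow>
     (\<exists>(G1 :: (nat, nat) metric_graph) (T :: (nat, nat) metric_graph) \<phi>.
        same_metric_graph G1 G \<and> well_contracted_cover G1 T \<phi> d)"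

end

theory Submission
  imports Defs
begin

text \<open>
  The obstruction is combinatorial. It is carried by a labelling of the vertices that records how a
  TIE-fighter is assembled: six parts, labelled \<open>L1, \<dots>, L4\<close> (the subgraphs of positive genus, called
  blobs below) and \<open>La, Lb\<close> (the two 3-valent vertices), each part connected,
  each blob containing a cycle, and exactly one edge for each of the six joints of the pattern, no
  others. Such a labelling survives everything that separates the canonical model from the source
  of a cover: subdividing an edge, inserting trees, deleting unbounded ends, and the inverse
  operations. Removing a leaf and removing a 2-valent vertex are both the contraction of an edge at
  a vertex of valence at most two, so that one lemma (\<open>edge_contraction.has_tie_partition_iff\<close>) covers
  both in both directions.

  Suppose now that a graph with such a labelling has a degree 3 well-contracted cover of a path. The
  position on the path is a height function whose fibres have total multiplicity 3, every vertex
  having multiplicity at least 1. At the highest point of a cycle either two edges of the cycle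
  leave downwards from one vertex or two vertices are joined by a contracted edge; in both cases the
  vertices of that blob take up multiplicity at least 2 in the fibre (\<open>leafless_heavy\<close>). So each blob
  \<open>p\<close> has a height \<open>q p\<close> at which it is that heavy, these four heights are distinct because
  \<open>2 + 2 > 3\<close>, and at height \<open>q p\<close> there is room for at most one vertex outside the blob.

  Two facts then exclude every order of the four heights. A connected set that has vertices below
  and above \<open>q p\<close> has one at \<open>q p\<close>, hence two disjoint such sets cannot both avoid the blob \<open>p\<close>. On
  the other hand, multiplicity at least 2 flows upwards from one heavy blob and at least 2 arrives
  at the next, and since \<open>2 + 2 > 3\<close> these flows must be connected strictly between the two heights
  (\<open>layering.up_crossing\<close>). If blob 1 had exactly one blob \<open>i\<close> below it, this connection would put a
  vertex of \<open>La\<close> below \<open>q L1\<close>; then \<open>La\<close> with one of the blobs 2, 3, and \<open>Lb\<close> with the two remaining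
  blobs, are two disjoint connected sets passing by blob 1. By symmetry blobs 1 and 4 are
  the extreme ones, say in the order 1, 2, 3, 4. The connection from blob 2 to blob 3 has to run
  through \<open>La\<close> or through \<open>Lb\<close>, so the ends in \<open>La\<close> of both edges from \<open>La\<close> to the blobs 2 and 3 lie
  strictly between \<open>q L2\<close> and \<open>q L3\<close>, or the same holds for \<open>Lb\<close>. But the connection from blob 1 to
  blob 2 leaves \<open>La\<close> by one of these two edges at a height below \<open>q L2\<close>, and the connection from
  blob 3 to blob 4 enters \<open>Lb\<close> by one of these two edges at a height above \<open>q L3\<close>: a contradiction
  in either case.
\<close>

section \<open>Connectedness by cuts\<close>

text \<open>Connectedness is expressed by cuts instead of walks: this form passes directly through contractions
  of edges, and it yields the discrete intermediate value property by cutting at a height.\<close>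

definition cut_connected :: "('v \<Rightarrow> 'v \<Rightarrow> bool) \<Rightarrow> 'v set \<Rightarrow> bool" where
  "cut_connected R W \<longleftrightarrow> (\<forall>S. S \<subseteq> W \<and> S \<noteq> {} \<and> S \<noteq> W \<longrightarrow> (\<exists>x\<in>S. \<exists>y\<in>W - S. R x y))"

lemma cut_connectedE:
  assumes "cut_connected R W" "S \<subseteq> W" "S \<noteq> {}" "S \<noteq> W"
  obtains x y where "x \<in> S" "y \<in> W - S" "R x y"
  using assms unfolding cut_connected_def by meson

lemma cut_connected_Un:
  assumes V: "cut_connected R V" and W: "cut_connected R W"
    and R: "symp R" "x \<in> V" "y \<in> W" "R x y"
  shows "cut_connected R (V \<union> W)"
  unfolding cut_connected_def
proof (intro allI impI, elim conjE)
  fix S assume S: "S \<subseteq> V \<union> W" "S \<noteq> {}" "S \<noteq> V \<union> W"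
  show "\<exists>x\<in>S. \<exists>y\<in>V \<union> W - S. R x y"
  proof (cases "(S \<inter> V = {} \<or> S \<inter> V = V) \<and> (S \<inter> W = {} \<or> S \<inter> W = W)")
    case True
    then have "(x \<in> S \<and> y \<notin> S) \<or> (y \<in> S \<and> x \<notin> S)"
      using S R by blast
    then show ?thesis
      using R by (meson DiffI UnCI sympD)
  next
    case False
    then consider "S \<inter> V \<noteq> {}" "S \<inter> V \<noteq> V" | "S \<inter> W \<noteq> {}" "S \<inter> W \<noteq> W"
      by blast
    then show ?thesis
    proof cases
      case 1
      then show ?thesis using cut_connectedE[OF V, of "S \<inter> V"] by (metis DiffE DiffI IntE IntI UnCI inf_le2)
    next
      case 2
      then show ?thesis using cut_connectedE[OF W, of "S \<inter> W"] by (metis DiffE DiffI IntE IntI UnCI inf_le2)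
    qed
  qed
qed

text \<open>A cut that separates \<open>w\<close> from its only neighbour \<open>y\<close> is useless for \<open>W - {w}\<close>; putting
  \<open>w\<close> on the side of \<open>y\<close> forces the crossing edge away from \<open>w\<close>.\<close>

lemma cut_connected_remove_leaf:
  assumes W: "cut_connected R W" and R: "symp R" and leaf: "\<And>x. x \<in> W \<Longrightarrow> R x w \<Longrightarrow> x = y"
  shows "cut_connected R (W - {w})"
  unfolding cut_connected_def
proof (intro allI impI, elim conjE)
  fix S assume S: "S \<subseteq> W - {w}" "S \<noteq> {}" "S \<noteq> W - {w}"
  show "\<exists>x\<in>S. \<exists>y\<in>W - {w} - S. R x y"
  proof (cases "w \<in> W")
    case True
    \<comment> \<open>Keeps \<open>w\<close> and \<open>y\<close> on the same side of the cut.\<close>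
    let ?S = "if y \<in> S then insert w S else S"
    obtain a b where ab: "a \<in> ?S" "b \<in> W - ?S" "R a b"
    proof (rule cut_connectedE[OF W, of ?S])
      show "?S \<subseteq> W" "?S \<noteq> {}" using S True by auto
      show "?S \<noteq> W" using S by (metis Diff_insert_absorb True subset_Diff_insert)
    qed
    have "a \<noteq> w"
    proof
      assume "a = w"
      then have "b = y" "y \<in> S" using leaf[of b] ab R S by (auto dest: sympD split: if_splits)
      then show False using ab by simp
    qed
    moreover have "b \<noteq> w"
    proof
      assume "b = w"
      then have "a = y" "y \<notin> S" using leaf[of a] ab S by (auto split: if_splits)
      then show False using ab by simp
    qed
    ultimately show ?thesis using ab by (auto split: if_splits)
  next
    case False
    then show ?thesis using cut_connectedE[OF W, of S] S by auto
  qed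
qed

text \<open>A cut of the quotient pulls back to a cut; conversely a cut either separates two points
  with the same image, which are related, or is the pullback of a cut of the quotient.\<close>

lemma cut_connected_quotient:
  assumes onto: "\<pi> ` W = W'"
    and fib: "\<And>x y. \<lbrakk>x \<in> W; y \<in> W; x \<noteq> y; \<pi> x = \<pi> y\<rbrakk> \<Longrightarrow> R x y"
    and lift: "\<And>x y. \<lbrakk>x \<in> W'; y \<in> W'; x \<noteq> y\<rbrakk> \<Longrightarrow>
      R' x y \<longleftrightarrow> (\<exists>x0 y0. x0 \<in> W \<and> y0 \<in> W \<and> \<pi> x0 = x \<and> \<pi> y0 = y \<and> R x0 y0)"
  shows "cut_connected R' W' \<longleftrightarrow> cut_connected R W"
proof
  assume C: "cut_connected R' W'"
  show "cut_connected R W"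
    unfolding cut_connected_def
  proof (intro allI impI, elim conjE)
    fix S assume S: "S \<subseteq> W" "S \<noteq> {}" "S \<noteq> W"
    show "\<exists>x\<in>S. \<exists>y\<in>W - S. R x y"
    proof (cases "\<exists>x\<in>S. \<exists>y\<in>W - S. \<pi> x = \<pi> y")
      case True
      then obtain x y where "x \<in> S" "y \<in> W - S" "\<pi> x = \<pi> y" by blast
      then show ?thesis using fib[of x y] S by blast
    next
      case False
      then have sat: "x \<in> S" if "x \<in> W" "\<pi> x \<in> \<pi> ` S" for x using that False by (metis DiffI imageE)
      have "\<pi> ` S \<noteq> W'" using sat S onto by blast
      then obtain x y where xy: "x \<in> \<pi> ` S" "y \<in> W' - \<pi> ` S" "R' x y"
        using cut_connectedE[OF C, of "\<pi> ` S"] S onto by blast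
      then obtain x0 y0 where "x0 \<in> W" "y0 \<in> W" "\<pi> x0 = x" "\<pi> y0 = y" "R x0 y0"
        using lift[of x y] S(1) onto by blast
      then show ?thesis using xy sat by blast
    qed
  qed
next
  assume C: "cut_connected R W"
  show "cut_connected R' W'"
    unfolding cut_connected_def
  proof (intro allI impI, elim conjE)
    fix S assume S: "S \<subseteq> W'" "S \<noteq> {}" "S \<noteq> W'"
    let ?S = "{x\<in>W. \<pi> x \<in> S}"
    have "?S \<noteq> {}" "?S \<noteq> W" using S onto by auto
    then obtain x y where xy: "x \<in> ?S" "y \<in> W - ?S" "R x y"
      using cut_connectedE[OF C, of ?S] by blast
    have W': "\<pi> x \<in> W'" "\<pi> y \<in> W'" using xy onto by auto
    have "\<pi> x \<noteq> \<pi> y" using xy by auto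
    then have "R' (\<pi> x) (\<pi> y)"
      using lift[OF W'] xy by blast
    then show "\<exists>x\<in>S. \<exists>y\<in>W' - S. R' x y" using xy W' by blast
  qed
qed

section \<open>Pairs of endpoints and degrees\<close>

lemma size2_iff: "size M = 2 \<longleftrightarrow> (\<exists>x y. M = {#x, y#})"
proof
  assume "size M = 2"
  then obtain x N where "M = add_mset x N" "size N = 1"
    by (metis One_nat_def Suc_1 nat.inject size_eq_Suc_imp_eq_union size_add_mset)
  then show "\<exists>x y. M = {#x, y#}" using size_1_singleton_mset[of N] by auto
qed auto

lemma mset_pair_eq: "{#a, b#} = {#x, y#} \<longleftrightarrow> a = x \<and> b = y \<or> a = y \<and> b = x"
proof
  assume eq: "{#a, b#} = {#x, y#}"
  then have "a \<in># {#x, y#}" by (metis union_single_eq_member)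
  then show "a = x \<and> b = y \<or> a = y \<and> b = x"
    using eq by (auto simp: add_mset_commute)
qed (auto simp: add_mset_commute)

text \<open>Recovers the two endpoints of an edge, in matching order, from their labels or images.\<close>

lemma image_mset_pair:
  assumes "image_mset f M = {#a, b#}"
  obtains x y where "M = {#x, y#}" "f x = a" "f y = b"
proof -
  obtain x N where "M = add_mset x N" "f x = a" "image_mset f N = {#b#}"
    using assms by (metis msed_map_invR)
  moreover from this(3) obtain y N' where "N = add_mset y N'" "f y = b" "image_mset f N' = {#}"
    by (metis msed_map_invR)
  ultimately show thesis using that by auto
qed

definition adj :: "('v, 'e, 'm) metric_graph_scheme \<Rightarrow> 'v \<Rightarrow> 'v \<Rightarrow> bool" where
  "adj G x y \<longleftrightarrow> (\<exists>e\<in>edges G. endpoints G e = {#x, y#})"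

lemma symp_adj: "symp (adj G)"
  unfolding adj_def by (auto intro!: sympI simp: add_mset_commute)

lemma size_endpoints_unbounded:
  "metric_graph G \<Longrightarrow> e \<in> edges G \<Longrightarrow> edge_length G e = \<infinity> \<Longrightarrow> size (endpoints G e) = 1"
  unfolding metric_graph_def by auto

lemma size_endpoints_le: "metric_graph G \<Longrightarrow> e \<in> edges G \<Longrightarrow> size (endpoints G e) \<le> 2"
  unfolding metric_graph_def by (auto split: if_splits)

lemma size_endpoints_bounded:
  "metric_graph G \<Longrightarrow> e \<in> edges G \<Longrightarrow> edge_length G e < \<infinity> \<Longrightarrow> size (endpoints G e) = 2"
  unfolding metric_graph_def by auto

definition deg_in :: "('v, 'e, 'm) metric_graph_scheme \<Rightarrow> 'e set \<Rightarrow> 'v \<Rightarrow> nat" where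
  "deg_in G F v = (\<Sum>e\<in>F. count (endpoints G e) v)"

text \<open>Records the presence of a cycle: unlike a cyclic list of vertices and edges, it changes in an obvious way when an edge is
  contracted, and vertices of degree at least two are all that is used of a cycle later.\<close>

definition leafless :: "('v, 'e, 'm) metric_graph_scheme \<Rightarrow> 'e set \<Rightarrow> bool" where
  "leafless G F \<longleftrightarrow>
     F \<noteq> {} \<and> F \<subseteq> edges G \<and> (\<forall>e\<in>F. size (endpoints G e) = 2) \<and> (\<forall>v. deg_in G F v \<noteq> 1)"

lemma endpoints_verts: "metric_graph G \<Longrightarrow> e \<in> edges G \<Longrightarrow> v \<in># endpoints G e \<Longrightarrow> v \<in> verts G"
  unfolding metric_graph_def by blast

lemma finite_edges: "metric_graph G \<Longrightarrow> finite (edges G)"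
  unfolding metric_graph_def by blast

lemma deg_in_mono: "finite F' \<Longrightarrow> F \<subseteq> F' \<Longrightarrow> deg_in G F v \<le> deg_in G F' v"
  unfolding deg_in_def by (rule sum_mono2) auto

lemma deg_in_insert: "finite F \<Longrightarrow> e \<notin> F \<Longrightarrow> deg_in G (insert e F) v = count (endpoints G e) v + deg_in G F v"
  unfolding deg_in_def by simp

lemma deg_in_le_valence: "metric_graph G \<Longrightarrow> F \<subseteq> edges G \<Longrightarrow> deg_in G F v \<le> valence G v"
  unfolding valence_def using deg_in_mono[of "edges G" F G v] finite_edges[of G] by (simp add: deg_in_def)

lemma deg_in_zero_iff: "finite F \<Longrightarrow> deg_in G F v = 0 \<longleftrightarrow> (\<forall>e\<in>F. v \<notin># endpoints G e)"
  unfolding deg_in_def by (simp add: not_in_iff)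

section \<open>Partitions in the shape of a TIE-fighter\<close>

datatype part = L1 | L2 | L3 | L4 | La | Lb

text \<open>The labels of the parts of positive genus.\<close>

definition blobs :: "part set" where
  "blobs = {L1, L2, L3, L4}"

text \<open>The six edges of the pattern, as pairs of labels.\<close>

definition joined :: "part multiset set" where
  "joined = {{#L1, La#}, {#L2, La#}, {#L3, La#}, {#L2, Lb#}, {#L3, Lb#}, {#L4, Lb#}}"

lemma joined_iff:
  "{#p, q#} \<in> joined \<longleftrightarrow>
     (p, q) \<in> {(L1, La), (L2, La), (L3, La), (L2, Lb), (L3, Lb), (L4, Lb),
               (La, L1), (La, L2), (La, L3), (Lb, L2), (Lb, L3), (Lb, L4)}"
  unfolding joined_def by (auto simp: add_eq_conv_ex)

text \<open>The parts need not be the original \<open>\<Gamma>\<^sub>i\<close>: trees and subdivision vertices are absorbed into them, and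
  in particular \<open>La\<close> and \<open>Lb\<close> may contain more than one vertex.\<close>

definition tie_partition :: "('v, 'e, 'm) metric_graph_scheme \<Rightarrow> ('v \<Rightarrow> part) \<Rightarrow> bool" where
  "tie_partition G c \<longleftrightarrow>
     (\<forall>p. cut_connected (adj G) {v\<in>verts G. c v = p}) \<and>
     (\<forall>M\<in>joined. \<exists>!e. e \<in> edges G \<and> image_mset c (endpoints G e) = M) \<and>
     (\<forall>e\<in>edges G. \<forall>x y. endpoints G e = {#x, y#} \<longrightarrow> c x \<noteq> c y \<longrightarrow> {#c x, c y#} \<in> joined) \<and>
     (\<forall>p\<in>blobs. \<exists>F. leafless G F \<and> (\<forall>e\<in>F. \<forall>v\<in>#endpoints G e. c v = p))"

definition has_tie_partition :: "('v, 'e, 'm) metric_graph_scheme \<Rightarrow> bool" where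
  "has_tie_partition G \<longleftrightarrow> (\<exists>c. tie_partition G c)"

lemma joinedE:
  assumes "M \<in> joined" obtains p p' where "M = {#p, p'#}" "p \<noteq> p'"
  using assms unfolding joined_def by auto

lemma tie_partition_cong:
  assumes G: "metric_graph G" and cd: "\<And>v. v \<in> verts G \<Longrightarrow> c v = d v"
  shows "tie_partition G c \<longleftrightarrow> tie_partition G d"
proof -
  note V = endpoints_verts[OF G]
  have 1: "{v\<in>verts G. c v = p} = {v\<in>verts G. d v = p}" for p using cd by auto
  have 2: "image_mset c (endpoints G e) = image_mset d (endpoints G e)" if "e \<in> edges G" for e
    by (rule image_mset_cong) (use V[OF that] cd in auto)
  then have 2: "(e \<in> edges G \<and> image_mset c (endpoints G e) = M) \<longleftrightarrow>
      (e \<in> edges G \<and> image_mset d (endpoints G e) = M)" for e M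
    by auto
  have 3: "(\<forall>x y. endpoints G e = {#x, y#} \<longrightarrow> c x \<noteq> c y \<longrightarrow> {#c x, c y#} \<in> joined) \<longleftrightarrow>
      (\<forall>x y. endpoints G e = {#x, y#} \<longrightarrow> d x \<noteq> d y \<longrightarrow> {#d x, d y#} \<in> joined)" if "e \<in> edges G" for e
  proof -
    have "c x = d x \<and> c y = d y" if "endpoints G e = {#x, y#}" for x y
      using V[OF \<open>e \<in> edges G\<close>] that cd by auto
    then show ?thesis by presburger
  qed
  have "(leafless G F \<and> (\<forall>e\<in>F. \<forall>v\<in>#endpoints G e. c v = p)) \<longleftrightarrow>
      (leafless G F \<and> (\<forall>e\<in>F. \<forall>v\<in>#endpoints G e. d v = p))" for F p
  proof (intro conj_cong refl ball_cong)
    fix e v assume "leafless G F" "e \<in> F" "v \<in># endpoints G e"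
    then have "v \<in> verts G" using V unfolding leafless_def by blast
    then show "c v = p \<longleftrightarrow> d v = p" using cd by simp
  qed
  then have 4: "(\<exists>F. leafless G F \<and> (\<forall>e\<in>F. \<forall>v\<in>#endpoints G e. c v = p)) \<longleftrightarrow>
      (\<exists>F. leafless G F \<and> (\<forall>e\<in>F. \<forall>v\<in>#endpoints G e. d v = p))" for p
    by simp
  show ?thesis
    unfolding tie_partition_def 1 2 by (intro conj_cong ball_cong refl 3 4)
qed

lemma tie_partition_delete:
  assumes e: "size (endpoints G e) = 1"
    and H: "verts H = verts G" "edges H = edges G - {e}" "endpoints H = endpoints G"
  shows "tie_partition H c \<longleftrightarrow> tie_partition G c"
proof -
  have no: "endpoints G e \<noteq> {#x, y#}" for x y using e by auto
  have adj: "adj H = adj G"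
    unfolding adj_def H by (intro ext) (use no in auto)
  have im: "image_mset c (endpoints G e) \<noteq> M" if "M \<in> joined" for M
  proof -
    have "size M = 2" using that unfolding joined_def by auto
    then show ?thesis using e by auto
  qed
  have deg: "deg_in H = deg_in G" unfolding deg_in_def H by simp
  have leafless: "leafless H F \<longleftrightarrow> leafless G F" for F
    unfolding leafless_def deg H using e by auto
  show ?thesis
    unfolding tie_partition_def adj leafless unfolding H
  proof (intro conj_cong refl)
    have "(f \<in> edges G - {e} \<and> image_mset c (endpoints G f) = M) \<longleftrightarrow>
        (f \<in> edges G \<and> image_mset c (endpoints G f) = M)" if "M \<in> joined" for f M
      using im[OF that] by blast
    then show "(\<forall>M\<in>joined. \<exists>!f. f \<in> edges G - {e} \<and> image_mset c (endpoints G f) = M) \<longleftrightarrow>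
        (\<forall>M\<in>joined. \<exists>!f. f \<in> edges G \<and> image_mset c (endpoints G f) = M)"
      by simp
    show "(\<forall>f\<in>edges G - {e}. \<forall>x y. endpoints G f = {#x, y#} \<longrightarrow> c x \<noteq> c y \<longrightarrow> {#c x, c y#} \<in> joined) \<longleftrightarrow>
        (\<forall>f\<in>edges G. \<forall>x y. endpoints G f = {#x, y#} \<longrightarrow> c x \<noteq> c y \<longrightarrow> {#c x, c y#} \<in> joined)"
      using no by blast
  qed
qed

lemma is_singleton_Collect: "is_singleton {e. P e} \<longleftrightarrow> (\<exists>!e. P e)"
  unfolding is_singleton_def by (metis mem_Collect_eq singletonD singletonI set_eqI)

text \<open>The part of the invariance that is common to isomorphisms (\<open>E0\<close> empty) and to the contraction of one
  edge (\<open>E0\<close> a singleton): a labelling of the quotient \<open>G\<close> is the same as a labelling of \<open>H\<close> that is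
  constant on the fibres of \<open>\<pi>\<close>. How leafless edge sets correspond differs in the two situations and is
  a hypothesis.\<close>

lemma tie_partition_quotient:
  fixes H :: "('v, 'e, 'm) metric_graph_scheme" and G :: "('w, 'f, 'n) metric_graph_scheme"
  assumes H: "metric_graph H"
    and onto: "\<pi> ` verts H = verts G"
    and \<rho>: "bij_betw \<rho> (edges H - E0) (edges G)"
    and ends: "\<And>e. e \<in> edges H - E0 \<Longrightarrow> endpoints G (\<rho> e) = image_mset \<pi> (endpoints H e)"
    and E0: "\<And>e. e \<in> E0 \<Longrightarrow> \<exists>x y. endpoints H e = {#x, y#} \<and> \<pi> x = \<pi> y"
    and fib: "\<And>x y. \<lbrakk>x \<in> verts H; y \<in> verts H; x \<noteq> y; \<pi> x = \<pi> y\<rbrakk> \<Longrightarrow> adj H x y"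
    and leafless: "\<And>p. (\<exists>F. leafless G F \<and> (\<forall>e\<in>F. \<forall>v\<in>#endpoints G e. c v = p)) \<longleftrightarrow>
        (\<exists>F. leafless H F \<and> (\<forall>e\<in>F. \<forall>v\<in>#endpoints H e. c (\<pi> v) = p))"
  shows "tie_partition G c \<longleftrightarrow> tie_partition H (\<lambda>v. c (\<pi> v))"
proof -
  note V = endpoints_verts[OF H]
  have inE0: "\<pi> x = \<pi> y" if "e \<in> E0" "endpoints H e = {#x, y#}" for e x y
    using E0[OF \<open>e \<in> E0\<close>] that mset_pair_eq by metis
  have edgesG: "e \<in> edges G \<longleftrightarrow> (\<exists>f\<in>edges H - E0. e = \<rho> f)" for e
    using \<rho> unfolding bij_betw_def by auto
  have adj: "adj G x y \<longleftrightarrow> (\<exists>x0 y0. \<pi> x0 = x \<and> \<pi> y0 = y \<and> adj H x0 y0)" if "x \<noteq> y" for x y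
  proof
    assume "adj G x y"
    then obtain e where e: "e \<in> edges G" "endpoints G e = {#x, y#}" unfolding adj_def by blast
    then obtain f where f: "f \<in> edges H - E0" "e = \<rho> f" using edgesG by blast
    have "image_mset \<pi> (endpoints H f) = {#x, y#}" using ends[OF f(1)] e f(2) by simp
    then obtain x0 y0 where "endpoints H f = {#x0, y0#}" "\<pi> x0 = x" "\<pi> y0 = y"
      by (rule image_mset_pair)
    then show "\<exists>x0 y0. \<pi> x0 = x \<and> \<pi> y0 = y \<and> adj H x0 y0"
      unfolding adj_def using f(1) by blast
  next
    assume "\<exists>x0 y0. \<pi> x0 = x \<and> \<pi> y0 = y \<and> adj H x0 y0"
    then obtain x0 y0 e where e: "\<pi> x0 = x" "\<pi> y0 = y" "e \<in> edges H" "endpoints H e = {#x0, y0#}"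
      unfolding adj_def by blast
    then have "e \<notin> E0" using inE0 that by blast
    then have "\<rho> e \<in> edges G" "endpoints G (\<rho> e) = {#x, y#}" using e ends edgesG by auto
    then show "adj G x y" unfolding adj_def by blast
  qed
  have 1: "cut_connected (adj G) {v\<in>verts G. c v = p} \<longleftrightarrow> cut_connected (adj H) {v\<in>verts H. c (\<pi> v) = p}" for p
  proof (rule cut_connected_quotient[of \<pi>])
    show "\<pi> ` {v \<in> verts H. c (\<pi> v) = p} = {v \<in> verts G. c v = p}" using onto by auto
    show "adj G x y = (\<exists>x0 y0. x0 \<in> {v \<in> verts H. c (\<pi> v) = p} \<and> y0 \<in> {v \<in> verts H. c (\<pi> v) = p} \<and>
        \<pi> x0 = x \<and> \<pi> y0 = y \<and> adj H x0 y0)"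
      if xy: "x \<in> {v \<in> verts G. c v = p}" "y \<in> {v \<in> verts G. c v = p}" "x \<noteq> y" for x y
    proof -
      have "x0 \<in> verts H \<and> y0 \<in> verts H" if "adj H x0 y0" for x0 y0
        using that V unfolding adj_def by fastforce
      then show ?thesis unfolding adj[OF xy(3)] using xy by blast
    qed
  qed (use fib in auto)
  have im: "image_mset c (endpoints G (\<rho> e)) = image_mset (\<lambda>v. c (\<pi> v)) (endpoints H e)" if "e \<in> edges H - E0" for e
    using ends[OF that] by (simp add: multiset.map_comp comp_def)
  have imE0: "image_mset (\<lambda>v. c (\<pi> v)) (endpoints H e) \<noteq> M" if E: "e \<in> E0" and M: "M \<in> joined" for e M
  proof -
    obtain x y where "endpoints H e = {#x, y#}" "\<pi> x = \<pi> y" using E0[OF E] by blast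
    moreover obtain p p' where "M = {#p, p'#}" "p \<noteq> p'" using M by (rule joinedE)
    ultimately show ?thesis by (auto simp: mset_pair_eq)
  qed
  have 2: "(\<exists>!e. e \<in> edges G \<and> image_mset c (endpoints G e) = M) \<longleftrightarrow>
      (\<exists>!e. e \<in> edges H \<and> image_mset (\<lambda>v. c (\<pi> v)) (endpoints H e) = M)" if M: "M \<in> joined" for M
  proof -
    have inj: "inj_on \<rho> (edges H - E0)" using \<rho> by (rule bij_betw_imp_inj_on)
    have "bij_betw \<rho> {e. e \<in> edges H \<and> image_mset (\<lambda>v. c (\<pi> v)) (endpoints H e) = M}
        {e. e \<in> edges G \<and> image_mset c (endpoints G e) = M}" (is "bij_betw _ ?A ?B")
      unfolding bij_betw_def
    proof
      have sub: "?A \<subseteq> edges H - E0" using imE0[OF _ M] by blast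
      then show "inj_on \<rho> ?A" using inj by (meson inj_on_subset)
      show "\<rho> ` ?A = ?B"
      proof
        show "\<rho> ` ?A \<subseteq> ?B"
        proof
          fix e assume "e \<in> \<rho> ` ?A"
          then obtain f where "f \<in> ?A" "e = \<rho> f" by blast
          then show "e \<in> ?B" using sub im[of f] edgesG by auto
        qed
        show "?B \<subseteq> \<rho> ` ?A"
        proof
          fix e assume e: "e \<in> ?B"
          then obtain f where f: "f \<in> edges H - E0" "e = \<rho> f" using edgesG by blast
          then have "f \<in> ?A" using e im[of f] by simp
          then show "e \<in> \<rho> ` ?A" using f by blast
        qed
      qed
    qed
    then have "card ?A = card ?B" by (rule bij_betw_same_card)
    then have "is_singleton ?A = is_singleton ?B" by (simp add: is_singleton_altdef)
    then show ?thesis by (simp add: is_singleton_Collect)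
  qed
  have 3: "(\<forall>e\<in>edges G. \<forall>x y. endpoints G e = {#x, y#} \<longrightarrow> c x \<noteq> c y \<longrightarrow> {#c x, c y#} \<in> joined) \<longleftrightarrow>
     (\<forall>e\<in>edges H. \<forall>x y. endpoints H e = {#x, y#} \<longrightarrow> c (\<pi> x) \<noteq> c (\<pi> y) \<longrightarrow> {#c (\<pi> x), c (\<pi> y)#} \<in> joined)"
    (is "?L \<longleftrightarrow> ?R")
  proof
    assume L: ?L
    show ?R
    proof (intro ballI allI impI)
      fix e x y assume e: "e \<in> edges H" "endpoints H e = {#x, y#}" "c (\<pi> x) \<noteq> c (\<pi> y)"
      then have "e \<notin> E0" using inE0 by metis
      then have "\<rho> e \<in> edges G" "endpoints G (\<rho> e) = {#\<pi> x, \<pi> y#}" using e ends edgesG by auto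
      then show "{#c (\<pi> x), c (\<pi> y)#} \<in> joined" using L e by blast
    qed
  next
    assume R: ?R
    show ?L
    proof (intro ballI allI impI)
      fix e x y assume e: "e \<in> edges G" "endpoints G e = {#x, y#}" "c x \<noteq> c y"
      then obtain f where f: "f \<in> edges H - E0" "e = \<rho> f" using edgesG by blast
      have "image_mset \<pi> (endpoints H f) = {#x, y#}" using ends[OF f(1)] e f(2) by simp
      then obtain x0 y0 where "endpoints H f = {#x0, y0#}" "\<pi> x0 = x" "\<pi> y0 = y"
        by (rule image_mset_pair)
      then show "{#c x, c y#} \<in> joined" using R e(3) f(1) by blast
    qed
  qed
  show ?thesis
    unfolding tie_partition_def 1 3 leafless using 2 by simp
qed
section \<open>Contracting an edge at a vertex of valence at most two\<close>

lemma count_image_merge: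
  assumes "u \<noteq> w"
  shows "count (image_mset (id(w := u)) M) v =
    (if v = w then 0 else if v = u then count M u + count M w else count M v)"
  using assms by (induction M) auto

text \<open>The edge \<open>e0\<close> is contracted and its end \<open>w\<close>, of valence at most two, is merged into \<open>u\<close>. If \<open>w\<close> has
  valence one, this removes a leaf; if it has valence two, it undoes a subdivision. The map \<open>\<rho>\<close> allows
  the surviving half of a subdivided edge to change its name.\<close>

locale edge_contraction =
  fixes H :: "('v, 'e, 'm) metric_graph_scheme" and G :: "('v, 'f, 'n) metric_graph_scheme"
    and u w :: 'v and e0 :: 'e and \<rho> :: "'e \<Rightarrow> 'f"
  assumes H: "metric_graph H"
    and u: "u \<in> verts H" and w: "w \<in> verts H" and uw: "u \<noteq> w"
    and e0: "e0 \<in> edges H" "endpoints H e0 = {#u, w#}"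
    and valence_w: "valence H w \<le> 2"
    and verts_G: "verts G = verts H - {w}"
    and \<rho>: "bij_betw \<rho> (edges H - {e0}) (edges G)"
    and ends: "\<And>f. f \<in> edges H - {e0} \<Longrightarrow> endpoints G (\<rho> f) = image_mset (id(w := u)) (endpoints H f)"
begin

abbreviation \<pi> :: "'v \<Rightarrow> 'v" where "\<pi> \<equiv> id(w := u)"

lemma fin: "F \<subseteq> edges H \<Longrightarrow> finite F"
  using finite_edges[OF H] finite_subset by blast

lemma deg_image:
  assumes "F \<subseteq> edges H - {e0}"
  shows "deg_in G (\<rho> ` F) v =
    (if v = w then 0 else if v = u then deg_in H F u + deg_in H F w else deg_in H F v)"
proof -
  have "inj_on \<rho> F" using \<rho> assms by (meson bij_betw_imp_inj_on inj_on_subset)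
  then have "deg_in G (\<rho> ` F) v = (\<Sum>f\<in>F. count (endpoints G (\<rho> f)) v)"
    unfolding deg_in_def by (simp add: sum.reindex)
  also have "\<dots> = (\<Sum>f\<in>F. count (image_mset \<pi> (endpoints H f)) v)"
    by (intro sum.cong refl) (use assms ends in \<open>simp add: subset_iff\<close>)
  finally show ?thesis
    unfolding count_image_merge[OF uw] deg_in_def by (simp add: sum.distrib)
qed

lemma deg_insert:
  assumes "F \<subseteq> edges H - {e0}"
  shows "deg_in H (insert e0 F) v = (if v = u \<or> v = w then 1 else 0) + deg_in H F v"
proof -
  have "F \<subseteq> edges H" "e0 \<notin> F" using assms by auto
  then show ?thesis using deg_in_insert[OF fin, of F e0 H v] e0 uw by auto
qed

text \<open>The edge \<open>e0\<close> already uses one of the at most two directions at \<open>w\<close>.\<close>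

lemma deg_w:
  assumes "F \<subseteq> edges H - {e0}" shows "deg_in H F w \<le> 1"
proof -
  have "insert e0 F \<subseteq> edges H" using assms e0 by auto
  then show ?thesis
    using deg_insert[OF assms, of w] deg_in_le_valence[OF H, of "insert e0 F" w] valence_w by simp
qed

text \<open>A leafless set upstairs loses \<open>e0\<close>: the degrees of \<open>u\<close> and \<open>w\<close> add up, and both were different from one
  before \<open>e0\<close> was removed. A leafless set downstairs is lifted and gains \<open>e0\<close> precisely when the lift
  would otherwise end at \<open>w\<close>.\<close>

lemma leafless_iff:
  "(\<exists>F. leafless G F \<and> (\<forall>e\<in>F. \<forall>v\<in>#endpoints G e. c v = p)) \<longleftrightarrow>
   (\<exists>F. leafless H F \<and> (\<forall>e\<in>F. \<forall>v\<in>#endpoints H e. c (\<pi> v) = p))"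
proof
  assume "\<exists>F. leafless G F \<and> (\<forall>e\<in>F. \<forall>v\<in>#endpoints G e. c v = p)"
  then obtain F where F: "leafless G F" and c: "\<And>e v. e \<in> F \<Longrightarrow> v \<in># endpoints G e \<Longrightarrow> c v = p"
    by blast
  define F0 where "F0 = {f \<in> edges H - {e0}. \<rho> f \<in> F}"
  have F0: "F0 \<subseteq> edges H - {e0}" by (auto simp: F0_def)
  have img: "\<rho> ` F0 = F"
    using \<rho> F unfolding F0_def bij_betw_def leafless_def by auto
  have sz: "size (endpoints H f) = 2" if "f \<in> F0" for f
    using F ends[of f] that F0 img unfolding leafless_def by (metis (full_types) image_eqI size_image_mset subsetD)
  have cH: "c (\<pi> v) = p" if "f \<in> F0" "v \<in># endpoints H f" for f v
  proof (rule c[of "\<rho> f"])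
    show "\<rho> f \<in> F" using that img by blast
    have "f \<in> edges H - {e0}" using that F0 by blast
    then show "\<pi> v \<in># endpoints G (\<rho> f)" unfolding ends[OF \<open>f \<in> edges H - {e0}\<close>] using that by simp
  qed
  \<comment> \<open>Degree one at \<open>w\<close> is repaired by \<open>e0\<close>, which at the same time restores the degree at \<open>u\<close>.\<close>
  define F1 where "F1 = (if deg_in H F0 w = 0 then F0 else insert e0 F0)"
  have sub: "F0 \<subseteq> F1" "F1 \<subseteq> insert e0 F0" by (auto simp: F1_def)
  have "deg_in H F1 v \<noteq> 1" for v
  proof -
    have "deg_in G F v \<noteq> 1" using F unfolding leafless_def by blast
    then have 1: "(if v = w then 0 else if v = u then deg_in H F0 u + deg_in H F0 w else deg_in H F0 v) \<noteq> 1"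
      using deg_image[OF F0, of v] img by simp
    show ?thesis
      unfolding F1_def using 1 deg_insert[OF F0, of v] deg_w[OF F0] uw by (auto split: if_splits)
  qed
  moreover have "F1 \<noteq> {}" using sub img F unfolding leafless_def by blast
  moreover have "F1 \<subseteq> edges H" using sub F0 e0 by blast
  moreover have "size (endpoints H f) = 2" if "f \<in> F1" for f
    using that sub sz e0 by auto
  ultimately have "leafless H F1" unfolding leafless_def by blast
  moreover have "c (\<pi> v) = p" if "f \<in> F1" "v \<in># endpoints H f" for f v
  proof (cases "f \<in> F0")
    case False
    then have "f = e0" "deg_in H F0 w \<noteq> 0" using that(1) by (auto simp: F1_def split: if_splits)
    then obtain g where "g \<in> F0" "w \<in># endpoints H g"
      using deg_in_zero_iff[OF fin, of F0 H w] F0 by auto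
    from cH[OF this] show ?thesis using that(2) \<open>f = e0\<close> e0 by auto
  qed (use cH that in blast)
  ultimately show "\<exists>F. leafless H F \<and> (\<forall>e\<in>F. \<forall>v\<in>#endpoints H e. c (\<pi> v) = p)" by blast
next
  assume "\<exists>F. leafless H F \<and> (\<forall>e\<in>F. \<forall>v\<in>#endpoints H e. c (\<pi> v) = p)"
  then obtain F where F: "leafless H F" and c: "\<And>e v. e \<in> F \<Longrightarrow> v \<in># endpoints H e \<Longrightarrow> c (\<pi> v) = p"
    by blast
  define F0 where "F0 = F - {e0}"
  have F0: "F0 \<subseteq> edges H - {e0}" using F by (auto simp: F0_def leafless_def)
  have F_eq: "F = (if e0 \<in> F then insert e0 F0 else F0)" by (auto simp: F0_def)
  have deg: "deg_in H F v = (if e0 \<in> F then (if v = u \<or> v = w then 1 else 0) else 0) + deg_in H F0 v" for v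
    using F_eq deg_insert[OF F0, of v] by (metis (full_types) add_0)
  have ne: "deg_in H F v \<noteq> 1" for v using F unfolding leafless_def by blast
  have "deg_in G (\<rho> ` F0) v \<noteq> 1" for v
    using deg_image[OF F0, of v] ne[of v] ne[of u] ne[of w] deg[of v] deg[of u] deg[of w]
    by (auto split: if_splits)
  moreover have "F0 \<noteq> {}"
    using ne[of w] deg[of w] F F_eq by (auto simp: deg_in_def leafless_def split: if_splits)
  moreover have "\<rho> ` F0 \<subseteq> edges G" using \<rho> F0 by (auto simp: bij_betw_def)
  moreover have "size (endpoints G (\<rho> f)) = 2" if "f \<in> F0" for f
  proof -
    have "f \<in> edges H - {e0}" "f \<in> F" using that F0 by (auto simp: F0_def)
    then show ?thesis using ends[of f] F unfolding leafless_def by simp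
  qed
  ultimately have "leafless G (\<rho> ` F0)" unfolding leafless_def by blast
  moreover have "c v = p" if fv: "f \<in> F0" "v \<in># endpoints G (\<rho> f)" for f v
  proof -
    have f: "f \<in> edges H - {e0}" "f \<in> F" using fv F0 by (auto simp: F0_def)
    then obtain v0 where "v0 \<in># endpoints H f" "\<pi> v0 = v"
      using fv(2) unfolding ends[OF f(1)] set_image_mset by blast
    then show ?thesis using c[OF f(2)] by blast
  qed
  ultimately show "\<exists>F. leafless G F \<and> (\<forall>e\<in>F. \<forall>v\<in>#endpoints G e. c v = p)" by blast
qed

lemma tie_partition_iff: "tie_partition G c \<longleftrightarrow> tie_partition H (\<lambda>v. c (\<pi> v))"
proof (rule tie_partition_quotient[of H \<pi> G \<rho> "{e0}"])
  show "\<pi> ` verts H = verts G" using u w uw verts_G by auto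
  have a: "adj H u w" "adj H w u"
    unfolding adj_def using e0 by (auto intro!: bexI[of _ e0] simp: add_mset_commute)
  show "adj H x y" if "x \<in> verts H" "y \<in> verts H" "x \<noteq> y" "\<pi> x = \<pi> y" for x y
    using that a by (auto split: if_splits)
  show "\<exists>x y. endpoints H e = {#x, y#} \<and> \<pi> x = \<pi> y" if "e \<in> {e0}" for e
    using that e0 uw by auto
qed (use H \<rho> ends in \<open>auto simp: leafless_iff simp del: fun_upd_apply\<close>)

lemma third_edge:
  assumes "g \<in> edges H" "f \<in> edges H" "f \<noteq> e0" "w \<in># endpoints H f" "g \<noteq> e0" "g \<noteq> f"
  shows "w \<notin># endpoints H g"
proof -
  have "deg_in H {f, g} w \<le> 1" using deg_w[of "{f, g}"] assms by auto
  then have "count (endpoints H f) w + count (endpoints H g) w \<le> 1"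
    using assms(6) by (simp add: deg_in_def)
  moreover have "0 < count (endpoints H f) w" using assms(4) by simp
  ultimately have "count (endpoints H g) w = 0" by linarith
  then show ?thesis by (simp add: not_in_iff)
qed

text \<open>If \<open>w\<close> were alone in its part, the part would be a blob, whose cycle would be a loop at \<open>w\<close>, or
  \<open>La\<close> or \<open>Lb\<close>, to which three edges of the pattern are attached. Either needs more directions at \<open>w\<close>
  than the valence allows.\<close>

lemma w_has_neighbour_in_class:
  assumes c: "tie_partition H c" and ne: "c u \<noteq> c w"
  shows "\<exists>f\<in>edges H. \<exists>y. endpoints H f = {#w, y#} \<and> c y = c w \<and> y \<noteq> w"
proof (cases "{v\<in>verts H. c v = c w} = {w}")
  case False
  then obtain x y where "x \<in> {w}" "y \<in> {v\<in>verts H. c v = c w} - {w}" "adj H x y"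
    using cut_connectedE[of "adj H" "{v\<in>verts H. c v = c w}" "{w}"] c w unfolding tie_partition_def by blast
  then show ?thesis unfolding adj_def by blast
next
  case True
  have False
  proof (cases "c w \<in> blobs")
    case True
    then obtain F where F: "leafless H F" and cF: "\<And>e v. e \<in> F \<Longrightarrow> v \<in># endpoints H e \<Longrightarrow> c v = c w"
      using c unfolding tie_partition_def by blast
    then obtain e where e: "e \<in> F" "e \<in> edges H" "size (endpoints H e) = 2" unfolding leafless_def by blast
    then obtain x y where xy: "endpoints H e = {#x, y#}" by (auto simp: size2_iff)
    have "x = w" "y = w"
      using cF[OF e(1)] endpoints_verts[OF H e(2)] xy \<open>{v\<in>verts H. c v = c w} = {w}\<close> by auto
    then have "deg_in H {e} w = 2" using xy by (simp add: deg_in_def)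
    moreover have "e \<noteq> e0" using xy e0 uw \<open>x = w\<close> \<open>y = w\<close> by (auto simp: mset_pair_eq)
    ultimately show False using deg_w[of "{e}"] e by simp
  next
    case False
    then have "\<exists>a b d. a \<noteq> b \<and> a \<noteq> d \<and> b \<noteq> d \<and> {#a, c w#} \<in> joined \<and> {#b, c w#} \<in> joined \<and> {#d, c w#} \<in> joined"
    proof (cases "c w")
      case La
      then show ?thesis by (intro exI[of _ L1] exI[of _ L2] exI[of _ L3]) (simp add: joined_iff)
    next
      case Lb
      then show ?thesis by (intro exI[of _ L2] exI[of _ L3] exI[of _ L4]) (simp add: joined_iff)
    qed (auto simp: blobs_def)
    then obtain a b d where abd: "a \<noteq> b" "a \<noteq> d" "b \<noteq> d"
        "{#a, c w#} \<in> joined" "{#b, c w#} \<in> joined" "{#d, c w#} \<in> joined"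
      by blast
    have edge: "\<exists>e\<in>edges H. image_mset c (endpoints H e) = {#a, c w#} \<and> w \<in># endpoints H e"
      if "{#a, c w#} \<in> joined" for a
    proof -
      obtain e where e: "e \<in> edges H" "image_mset c (endpoints H e) = {#a, c w#}"
        using c \<open>{#a, c w#} \<in> joined\<close> unfolding tie_partition_def by blast
      then obtain x y where "endpoints H e = {#x, y#}" "c x = a" "c y = c w" by (metis image_mset_pair)
      moreover from this have "y = w" using endpoints_verts[OF H e(1), of y] True by auto
      ultimately have "w \<in># endpoints H e" by simp
      then show ?thesis using e by blast
    qed
    obtain x y z where xyz: "x \<in> edges H" "y \<in> edges H" "z \<in> edges H"
        "image_mset c (endpoints H x) = {#a, c w#}" "w \<in># endpoints H x"
        "image_mset c (endpoints H y) = {#b, c w#}" "w \<in># endpoints H y"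
        "image_mset c (endpoints H z) = {#d, c w#}" "w \<in># endpoints H z"
      using edge[OF abd(4)] edge[OF abd(5)] edge[OF abd(6)] by blast
    then have d: "x \<noteq> y" "x \<noteq> z" "y \<noteq> z" using abd(1-3) by auto
    have "deg_in H {x, y, z} w \<le> 2"
      using deg_in_le_valence[OF H, of "{x, y, z}" w] valence_w xyz by simp
    then have "count (endpoints H x) w + count (endpoints H y) w + count (endpoints H z) w \<le> 2"
      using d by (simp add: deg_in_def)
    moreover have "0 < count (endpoints H x) w" "0 < count (endpoints H y) w" "0 < count (endpoints H z) w"
      using xyz by simp_all
    ultimately show False by linarith
  qed
  then show ?thesis ..
qed

text \<open>If \<open>e0\<close> is itself one of the six joints, then the other edge \<open>f\<close> at \<open>w\<close> stays inside the part of \<open>w\<close>.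
  Moving \<open>w\<close> to the part of \<open>u\<close> makes \<open>f\<close> the joint in place of \<open>e0\<close>.\<close>

lemma give_w_label_of_u:
  assumes c: "tie_partition H c"
  shows "\<exists>d. tie_partition H d \<and> d u = d w"
proof (cases "c u = c w")
  case True
  then show ?thesis using c by blast
next
  case ne: False
  obtain f y where f: "f \<in> edges H" "endpoints H f = {#w, y#}" "c y = c w" "y \<noteq> w"
    using w_has_neighbour_in_class[OF c ne] by blast
  have "y \<noteq> u" using f ne by auto
  then have fe: "f \<noteq> e0" using f e0 uw by (auto simp: mset_pair_eq)
  define d where "d = c(w := c u)"
  have other: "w \<notin># endpoints H g" if "g \<in> edges H" "g \<noteq> e0" "g \<noteq> f" for g
    using third_edge[OF that(1) f(1) fe _ that(2,3)] f(2) by simp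
  have same: "image_mset d (endpoints H g) = image_mset c (endpoints H g)" if "w \<notin># endpoints H g" for g
    by (rule image_mset_cong) (use that in \<open>auto simp: d_def\<close>)
  have im: "image_mset c (endpoints H e0) = {#c u, c w#}" "image_mset d (endpoints H e0) = {#c u, c u#}"
    "image_mset c (endpoints H f) = {#c w, c w#}" "image_mset d (endpoints H f) = {#c u, c w#}"
    using e0 f uw by (auto simp: d_def)
  have diag: "{#p, p#} \<notin> joined" for p by (cases p) (simp_all add: joined_iff)
  have cross: "{#c u, c w#} \<in> joined"
    using c e0 ne unfolding tie_partition_def by blast
  have uniq: "\<exists>!e. e \<in> edges H \<and> image_mset c (endpoints H e) = M" if "M \<in> joined" for M
    using c that unfolding tie_partition_def by blast
  have adj_w: "adj H x w \<longleftrightarrow> x = u \<or> x = y" for x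
  proof
    assume "adj H x w"
    then obtain g where g: "g \<in> edges H" "endpoints H g = {#x, w#}" unfolding adj_def by blast
    then have "g = e0 \<or> g = f" using other[of g] by auto
    then show "x = u \<or> x = y" using g e0 f by (auto simp: mset_pair_eq)
  next
    assume "x = u \<or> x = y"
    then show "adj H x w" unfolding adj_def using e0 f by (metis add_mset_commute)
  qed
  have "tie_partition H d"
    unfolding tie_partition_def
  proof (intro conjI allI ballI impI)
    fix p
    have C: "cut_connected (adj H) {v\<in>verts H. c v = p}" for p using c unfolding tie_partition_def by blast
    consider "p = c w" | "p = c u" | "p \<noteq> c w" "p \<noteq> c u" by blast
    then show "cut_connected (adj H) {v\<in>verts H. d v = p}"
    proof cases
      case 1
      then have "{v\<in>verts H. d v = p} = {v\<in>verts H. c v = c w} - {w}"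
        using ne by (auto simp: d_def)
      moreover have "cut_connected (adj H) ({v\<in>verts H. c v = c w} - {w})"
        by (rule cut_connected_remove_leaf[OF C symp_adj, of _ _ y]) (use ne adj_w in auto)
      ultimately show ?thesis by simp
    next
      case 2
      then have "{v\<in>verts H. d v = p} = {v\<in>verts H. c v = c u} \<union> {w}"
        using ne w by (auto simp: d_def)
      moreover have "cut_connected (adj H) ({v\<in>verts H. c v = c u} \<union> {w})"
      proof (rule cut_connected_Un[OF C _ symp_adj, where x = u and y = w])
        show "cut_connected (adj H) {w}" unfolding cut_connected_def by blast
      qed (use u adj_w in auto)
      ultimately show ?thesis by simp
    next
      case 3
      then have "{v\<in>verts H. d v = p} = {v\<in>verts H. c v = p}" by (auto simp: d_def)
      then show ?thesis using C by simp
    qed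
  next
    fix M assume M: "M \<in> joined"
    show "\<exists>!e. e \<in> edges H \<and> image_mset d (endpoints H e) = M"
    proof (cases "M = {#c u, c w#}")
      case True
      show ?thesis
      proof (rule ex1I[of _ f])
        show "f \<in> edges H \<and> image_mset d (endpoints H f) = M" using True f im by simp
        show "g = f" if "g \<in> edges H \<and> image_mset d (endpoints H g) = M" for g
        proof (rule ccontr)
          assume "g \<noteq> f"
          moreover have "g \<noteq> e0" using that im diag M by metis
          ultimately have "image_mset c (endpoints H g) = M" using that same[OF other] by auto
          then show False using that uniq[OF M] im True e0 \<open>g \<noteq> e0\<close> by metis
        qed
      qed
    next
      case False
      have "(e \<in> edges H \<and> image_mset d (endpoints H e) = M) \<longleftrightarrow>
            (e \<in> edges H \<and> image_mset c (endpoints H e) = M)" for e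
      proof (cases "e = e0 \<or> e = f")
        case True
        then show ?thesis using im False M diag by metis
      next
        case False
        then show ?thesis using same[OF other, of e] by auto
      qed
      then show ?thesis using uniq[OF M] by simp
    qed
  next
    fix e x y' assume e: "e \<in> edges H" "endpoints H e = {#x, y'#}" "d x \<noteq> d y'"
    have "image_mset d (endpoints H e) = {#d x, d y'#}" using e by simp
    moreover have "image_mset c (endpoints H e) = {#c x, c y'#}" using e by simp
    moreover have "c x \<noteq> c y' \<Longrightarrow> {#c x, c y'#} \<in> joined"
      using c e unfolding tie_partition_def by blast
    ultimately show "{#d x, d y'#} \<in> joined"
      using im cross other[OF e(1)] same e by (metis mset_pair_eq)
  next
    fix p assume "p \<in> blobs"
    then obtain F where F: "leafless H F" and cF: "\<And>e v. e \<in> F \<Longrightarrow> v \<in># endpoints H e \<Longrightarrow> c v = p"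
      using c unfolding tie_partition_def by blast
    have FH: "F \<subseteq> edges H" using F unfolding leafless_def by blast
    have "w \<notin># endpoints H e" if "e \<in> F" for e
    proof
      assume w: "w \<in># endpoints H e"
      then have "p = c w" using cF that by blast
      then have "e0 \<notin> F" using cF[of e0 u] ne e0 by auto
      then have "deg_in H F w \<le> 1" using deg_w FH by blast
      then have "deg_in H F w = 0" using F unfolding leafless_def by (metis le_antisym less_one not_le)
      then have "\<forall>f\<in>F. w \<notin># endpoints H f" using deg_in_zero_iff[OF fin[OF FH], of H w] by simp
      then show False using that w by simp
    qed
    then have "d v = p" if "e \<in> F" "v \<in># endpoints H e" for e v
      using cF[OF that] that by (metis d_def fun_upd_other)
    then show "\<exists>F. leafless H F \<and> (\<forall>e\<in>F. \<forall>v\<in>#endpoints H e. d v = p)" using F by blast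
  qed
  moreover have "d u = d w" using uw by (simp add: d_def)
  ultimately show ?thesis by blast
qed

lemma has_tie_partition_iff: "has_tie_partition H \<longleftrightarrow> has_tie_partition G"
proof
  assume "has_tie_partition H"
  then obtain d where d: "tie_partition H d" "d u = d w"
    unfolding has_tie_partition_def using give_w_label_of_u by blast
  have "tie_partition H d \<longleftrightarrow> tie_partition H (\<lambda>v. d (\<pi> v))"
    by (rule tie_partition_cong[OF H]) (use d in auto)
  then show "has_tie_partition G"
    unfolding has_tie_partition_def using d tie_partition_iff by blast
next
  assume "has_tie_partition G"
  then show "has_tie_partition H"
    unfolding has_tie_partition_def using tie_partition_iff by blast
qed

end

section \<open>Independence of the model and of the trees\<close>

text \<open>An isomorphism is a contraction of no edges; a labelling is transported forwards by the inverse on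
  vertices.\<close>

lemma has_tie_partition_iso:
  fixes H :: "('v, 'e, 'm) metric_graph_scheme" and G :: "('w, 'f, 'n) metric_graph_scheme"
  assumes H: "metric_graph H" and iso: "isomorphic_models H G"
  shows "has_tie_partition H \<longleftrightarrow> has_tie_partition G"
proof -
  obtain f g where f: "bij_betw f (verts H) (verts G)" and g: "bij_betw g (edges H) (edges G)"
    and fg: "\<And>e. e \<in> edges H \<Longrightarrow> endpoints G (g e) = image_mset f (endpoints H e)"
    using iso unfolding isomorphic_models_def by blast
  have inj: "inj_on f (verts H)" using f by (rule bij_betw_imp_inj_on)
  have deg: "deg_in G (g ` F) x = (\<Sum>v\<in>{v\<in>verts H. f v = x}. deg_in H F v)" if F: "F \<subseteq> edges H" for F x
  proof -
    have fin: "finite F" "finite (verts H)" using F finite_edges[OF H] H finite_subset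
      unfolding metric_graph_def by blast+
    have "inj_on g F" using g F by (meson bij_betw_imp_inj_on inj_on_subset)
    then have "deg_in G (g ` F) x = (\<Sum>e\<in>F. count (endpoints G (g e)) x)"
      unfolding deg_in_def by (simp add: sum.reindex)
    also have "\<dots> = (\<Sum>e\<in>F. \<Sum>v\<in>{v\<in>verts H. f v = x}. count (endpoints H e) v)"
    proof (rule sum.cong[OF refl])
      fix e assume "e \<in> F"
      then have e: "e \<in> edges H" using F by blast
      show "count (endpoints G (g e)) x = (\<Sum>v\<in>{v\<in>verts H. f v = x}. count (endpoints H e) v)"
        unfolding fg[OF e] count_image_mset
        by (rule sum.mono_neutral_left)
          (use fin endpoints_verts[OF H e] in \<open>auto simp: not_in_iff\<close>)
    qed
    also have "\<dots> = (\<Sum>v\<in>{v\<in>verts H. f v = x}. deg_in H F v)"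
      unfolding deg_in_def by (rule sum.swap)
    finally show ?thesis .
  qed
  have leafless: "leafless G (g ` F) \<longleftrightarrow> leafless H F" if F: "F \<subseteq> edges H" for F
  proof -
    have "(\<forall>x. deg_in G (g ` F) x \<noteq> 1) \<longleftrightarrow> (\<forall>v. deg_in H F v \<noteq> 1)"
    proof
      assume *: "\<forall>x. deg_in G (g ` F) x \<noteq> 1"
      show "\<forall>v. deg_in H F v \<noteq> 1"
      proof
        fix v
        show "deg_in H F v \<noteq> 1"
        proof (cases "v \<in> verts H")
          case True
          then have "{v'\<in>verts H. f v' = f v} = {v}" using inj by (auto dest: inj_onD)
          then show ?thesis using deg[OF F, of "f v"] *[rule_format, of "f v"] by simp
        next
          case False
          have "finite F" using F finite_edges[OF H] finite_subset by blast
          then have "deg_in H F v = 0"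
            using deg_in_zero_iff[of F H v] False endpoints_verts[OF H] F by blast
          then show ?thesis by simp
        qed
      qed
    next
      assume *: "\<forall>v. deg_in H F v \<noteq> 1"
      show "\<forall>x. deg_in G (g ` F) x \<noteq> 1"
      proof
        fix x
        show "deg_in G (g ` F) x \<noteq> 1"
        proof (cases "\<exists>v\<in>verts H. f v = x")
          case True
          then obtain v where v: "v \<in> verts H" "f v = x" by blast
          then have "{v'\<in>verts H. f v' = x} = {v}" using inj by (auto dest: inj_onD)
          then show ?thesis using deg[OF F, of x] * by simp
        next
          case False
          then have "{v'\<in>verts H. f v' = x} = {}" by blast
          then show ?thesis using deg[OF F, of x] by (metis sum.empty zero_neq_one)
        qed
      qed
    qed
    moreover have "(\<forall>e\<in>g ` F. size (endpoints G e) = 2) \<longleftrightarrow> (\<forall>e\<in>F. size (endpoints H e) = 2)"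
      using fg F by (auto simp: subset_iff)
    moreover have "g ` F \<subseteq> edges G" using F g by (auto simp: bij_betw_def)
    ultimately show ?thesis unfolding leafless_def using F by simp
  qed
  have iff: "tie_partition G c \<longleftrightarrow> tie_partition H (\<lambda>v. c (f v))" for c
  proof (rule tie_partition_quotient[of H f G g "{}"])
    show "f ` verts H = verts G" using f by (rule bij_betw_imp_surj_on)
    show "bij_betw g (edges H - {}) (edges G)" using g by simp
    show "adj H x y" if "x \<in> verts H" "y \<in> verts H" "x \<noteq> y" "f x = f y" for x y
      using inj that by (auto dest: inj_onD)
    fix p
    show "(\<exists>F. leafless G F \<and> (\<forall>e\<in>F. \<forall>v\<in>#endpoints G e. c v = p)) \<longleftrightarrow>
          (\<exists>F. leafless H F \<and> (\<forall>e\<in>F. \<forall>v\<in>#endpoints H e. c (f v) = p))" (is "?L \<longleftrightarrow> ?R")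
    proof
      assume ?L
      then obtain F' where F': "leafless G F'" "\<forall>e\<in>F'. \<forall>v\<in>#endpoints G e. c v = p" by blast
      then have "F' \<subseteq> g ` edges H" using g unfolding leafless_def bij_betw_def by blast
      then obtain F where F: "F \<subseteq> edges H" "F' = g ` F" by (meson subset_imageE)
      have "c (f v) = p" if "e \<in> F" "v \<in># endpoints H e" for e v
      proof -
        have "f v \<in># endpoints G (g e)" using that F(1) fg[of e] by auto
        then show ?thesis using F'(2) that(1) F(2) by blast
      qed
      then show ?R using F' F leafless[OF F(1)] by blast
    next
      assume ?R
      then obtain F where F: "leafless H F" "\<forall>e\<in>F. \<forall>v\<in>#endpoints H e. c (f v) = p" by blast
      then have sub: "F \<subseteq> edges H" unfolding leafless_def by blast
      have "c x = p" if "e \<in> F" "x \<in># endpoints G (g e)" for e x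
      proof -
        have "x \<in># image_mset f (endpoints H e)" using that sub fg[of e] by auto
        then show ?thesis using F(2) that(1) by auto
      qed
      then show ?L using F leafless[OF sub] by blast
    qed
  qed (use H fg in auto)
  show ?thesis
  proof
    assume "has_tie_partition H"
    then obtain c where c: "tie_partition H c" unfolding has_tie_partition_def by blast
    have "tie_partition H c \<longleftrightarrow> tie_partition H (\<lambda>v. c (inv_into (verts H) f (f v)))"
      by (rule tie_partition_cong[OF H]) (use inj in simp)
    then have "tie_partition G (\<lambda>x. c (inv_into (verts H) f x))"
      using c iff[of "\<lambda>x. c (inv_into (verts H) f x)"] by simp
    then show "has_tie_partition G" unfolding has_tie_partition_def by blast
  next
    assume "has_tie_partition G"
    then show "has_tie_partition H" unfolding has_tie_partition_def using iff by blast
  qed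
qed

lemma metric_graph_iso:
  assumes "metric_graph H" "isomorphic_models H G"
  shows "metric_graph G"
proof -
  obtain f g where f: "bij_betw f (verts H) (verts G)" and g: "bij_betw g (edges H) (edges G)"
    and fg: "\<And>e. e \<in> edges H \<Longrightarrow> endpoints G (g e) = image_mset f (endpoints H e) \<and>
      edge_length G (g e) = edge_length H e"
    using assms(2) unfolding isomorphic_models_def by blast
  have "verts G = f ` verts H" "edges G = g ` edges H" using f g unfolding bij_betw_def by auto
  then show ?thesis
    using assms(1) fg unfolding metric_graph_def by fastforce
qed

lemma image_merge_idle: "w \<notin># M \<Longrightarrow> image_mset (id(w := u)) M = M"
  by (induction M) auto

text \<open>The inserted vertex \<open>w\<close> has the two halves \<open>e1\<close>, \<open>e2\<close> as its only edges, and contracting \<open>e1\<close>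
  gives the original graph back.\<close>

lemma has_tie_partition_subdivision:
  assumes G: "metric_graph G" and sub: "subdivision G H"
  shows "metric_graph H \<and> (has_tie_partition H \<longleftrightarrow> has_tie_partition G)"
proof -
  obtain e e1 e2 u w M where e: "e \<in> edges G" "endpoints G e = add_mset u M" "w \<notin> verts G"
    "e1 \<noteq> e2" "e1 \<notin> edges G - {e}" "e2 \<notin> edges G - {e}"
    and VE: "verts H = insert w (verts G)" "edges H = (edges G - {e}) \<union> {e1, e2}"
    and ends: "endpoints H e1 = {#u, w#}" "endpoints H e2 = add_mset w M"
    and len: "0 < edge_length H e1" "edge_length H e1 < \<infinity>" "0 < edge_length H e2"
      "edge_length G e = edge_length H e1 + edge_length H e2"
    and other': "\<forall>f\<in>edges G - {e}. endpoints H f = endpoints G f \<and> edge_length H f = edge_length G f"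
    using sub unfolding subdivision_def by (elim exE conjE) (rule that; assumption)
  note other = bspec[OF other']
  note V = endpoints_verts[OF G]
  have uM: "u \<in> verts G" "set_mset M \<subseteq> verts G" using V[OF e(1)] e(2) by auto
  have wM: "w \<notin># M" "u \<noteq> w" using uM e(3) by auto
  have inf: "edge_length G e = \<infinity> \<longleftrightarrow> edge_length H e2 = \<infinity>"
    using len by (cases "edge_length H e1"; cases "edge_length H e2") auto
  have sz: "Suc (size M) = (if edge_length G e = \<infinity> then 1 else 2)"
    using G e unfolding metric_graph_def by (metis size_add_mset)
  have "set_mset (endpoints H f) \<subseteq> verts H \<and> 0 < edge_length H f \<and>
        size (endpoints H f) = (if edge_length H f = \<infinity> then 1 else 2)" if f: "f \<in> edges H" for f
  proof -
    consider "f = e1" | "f = e2" | "f \<in> edges G - {e}" using f unfolding VE(2) by blast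
    then show ?thesis
    proof cases
      case 1
      then show ?thesis using ends len uM VE by auto
    next
      case 2
      then show ?thesis using ends len uM VE sz inf by auto
    next
      case 3
      then show ?thesis using other[OF 3] G VE unfolding metric_graph_def by auto
    qed
  qed
  then have H: "metric_graph H"
    using G VE unfolding metric_graph_def by auto
  have noth: "w \<notin># endpoints H f" if "f \<in> edges G - {e}" for f
    using other[OF that] V[of f w] e(3) that by auto
  have count_w: "(\<Sum>f\<in>edges G - {e}. count (endpoints H f) w) = 0"
    using noth by (simp add: not_in_iff)
  let ?\<rho> = "\<lambda>f. if f = e2 then e else f"
  interpret edge_contraction H G u w e1 ?\<rho>
  proof
    show "metric_graph H" by (rule H)
    have "valence H w = (\<Sum>f\<in>insert e1 (insert e2 (edges G - {e})). count (endpoints H f) w)"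
      unfolding valence_def VE by (simp add: insert_commute)
    also have "\<dots> = 2"
      using count_w e finite_edges[OF G] ends wM by (simp add: not_in_iff)
    finally show "valence H w \<le> 2" by simp
    have E: "edges H - {e1} = insert e2 (edges G - {e})" using VE e by auto
    show "bij_betw ?\<rho> (edges H - {e1}) (edges G)"
      unfolding E bij_betw_def inj_on_def using e by auto
    show "endpoints G (?\<rho> f) = image_mset (id(w := u)) (endpoints H f)" if f: "f \<in> edges H - {e1}" for f
    proof (cases "f = e2")
      case True
      have "image_mset (id(w := u)) M = M"
        using wM by (simp add: image_merge_idle)
      then show ?thesis using True ends e by simp
    next
      case False
      then have "f \<in> edges G - {e}" using f E by blast
      moreover have "image_mset (id(w := u)) (endpoints H f) = endpoints H f"
        using noth[OF calculation] by (rule image_merge_idle)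
      ultimately show ?thesis using False other by simp
    qed
  qed (use VE uM wM e ends in auto)
  show ?thesis using H has_tie_partition_iff by simp
qed

lemma has_tie_partition_refinement:
  assumes "refinement R G"
  shows "metric_graph G" "has_tie_partition R \<longleftrightarrow> has_tie_partition G"
proof -
  obtain G0 where G: "metric_graph G" and iso: "isomorphic_models G G0" and sub: "subdivision\<^sup>*\<^sup>* G0 R"
    using assms unfolding refinement_def by blast
  show "metric_graph G" by (rule G)
  have "metric_graph R \<and> (has_tie_partition R \<longleftrightarrow> has_tie_partition G0)"
    using sub
  proof (induction rule: rtranclp_induct)
    case base
    show ?case using metric_graph_iso[OF G iso] by simp
  next
    case (step A B)
    then show ?case using has_tie_partition_subdivision[of A B] by simp
  qed
  then show "has_tie_partition R \<longleftrightarrow> has_tie_partition G"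
    using has_tie_partition_iso[OF G iso] by simp
qed

lemma has_tie_partition_same:
  assumes "same_metric_graph G H"
  shows "metric_graph G" "metric_graph H" "has_tie_partition G \<longleftrightarrow> has_tie_partition H"
proof -
  obtain R :: "(nat, nat) metric_graph" where R: "refinement R G" "refinement R H"
    using assms unfolding same_metric_graph_def by blast
  show "metric_graph G" "metric_graph H" "has_tie_partition G \<longleftrightarrow> has_tie_partition H"
    using has_tie_partition_refinement[OF R(1)] has_tie_partition_refinement[OF R(2)] by simp_all
qed

text \<open>An unbounded end has a single endpoint, so that it is neither a joint nor part of a leafless set;
  removing a leaf is a contraction.\<close>

lemma has_tie_partition_shrink_step:
  assumes "shrink_step G C" "metric_graph G"
  shows "metric_graph C \<and> (has_tie_partition G \<longleftrightarrow> has_tie_partition C)"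
  using assms
proof cases
  case (unbounded_end e)
  have "metric_graph C"
    using assms(2) unbounded_end(1) unfolding metric_graph_def by auto
  moreover have "tie_partition C c \<longleftrightarrow> tie_partition G c" for c
    by (rule tie_partition_delete[of G e])
      (simp_all add: unbounded_end(1) size_endpoints_unbounded[OF assms(2) unbounded_end(2,3)])
  ultimately show ?thesis unfolding has_tie_partition_def by blast
next
  case (leaf_edge v e)
  note G = \<open>metric_graph G\<close>
  have "size (endpoints G e) = 2"
    by (rule size_endpoints_bounded[OF G leaf_edge(4,6)])
  then obtain u where u: "endpoints G e = {#u, v#}"
    using leaf_edge(5) unfolding size2_iff by (auto simp: add_mset_commute)
  have fin: "finite (edges G)" by (rule finite_edges[OF G])
  have sum: "count (endpoints G e) v + (\<Sum>f\<in>edges G - {e}. count (endpoints G f) v) = 1"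
    using leaf_edge(3) unfolding valence_def sum.remove[OF fin leaf_edge(4)] .
  then have uv: "u \<noteq> v" using u by auto
  then have "(\<Sum>f\<in>edges G - {e}. count (endpoints G f) v) = 0" using sum u by simp
  then have noth: "v \<notin># endpoints G f" if "f \<in> edges G - {e}" for f
    using that fin by (simp add: not_in_iff)
  have u': "u \<in> verts G" using endpoints_verts[OF G leaf_edge(4), of u] u by simp
  have C: "metric_graph C"
    using G noth u' uv unfolding leaf_edge(1) metric_graph_def by auto
  \<comment> \<open>The leaf \<open>v\<close> is merged into its neighbour.\<close>
  interpret edge_contraction G C u v e "\<lambda>f. f"
  proof
    show "endpoints C f = image_mset (id(v := u)) (endpoints G f)" if "f \<in> edges G - {e}" for f
      using image_merge_idle[OF noth[OF that]] by (simp add: leaf_edge(1))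
  qed (use G u u' uv leaf_edge in \<open>auto simp: bij_betw_def\<close>)
  show ?thesis using C has_tie_partition_iff by simp
qed

lemma has_tie_partition_canonical_model:
  assumes "canonical_model G C" "metric_graph G"
  shows "has_tie_partition G \<longleftrightarrow> has_tie_partition C"
proof -
  have "shrink_step\<^sup>*\<^sup>* G C" using assms(1) unfolding canonical_model_def by blast
  then have "metric_graph C \<and> (has_tie_partition G \<longleftrightarrow> has_tie_partition C)"
    by (induction rule: rtranclp_induct) (use assms(2) has_tie_partition_shrink_step in blast)+
  then show ?thesis by blast
qed

section \<open>TIE-fighter graphs have such a partition\<close>

lemma cut_connected_connected_graph:
  assumes S: "metric_graph S" and C: "connected_graph S"
  shows "cut_connected (adj S) (verts S)"
  unfolding cut_connected_def
proof (intro allI impI, elim conjE)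
  fix A assume A: "A \<subseteq> verts S" "A \<noteq> {}" "A \<noteq> verts S"
  then obtain a b where ab: "a \<in> A" "b \<in> verts S - A" by blast
  then have "(a, b) \<in> {(x, y). \<exists>e\<in>edges S. endpoints S e = {#x, y#}}\<^sup>*"
    using C A unfolding connected_graph_def by blast
  then have "b \<in> A \<or> (\<exists>x\<in>A. \<exists>y\<in>verts S - A. adj S x y)"
  proof (induction rule: rtrancl_induct)
    case base
    show ?case using ab by blast
  next
    case (step y z)
    then obtain e where e: "e \<in> edges S" "endpoints S e = {#y, z#}" by blast
    then have "z \<in> verts S" using endpoints_verts[OF S, of e z] by simp
    then show ?case using step e unfolding adj_def by blast
  qed
  then show "\<exists>x\<in>A. \<exists>y\<in>verts S - A. adj S x y" using ab by blast
qed

text \<open>Each vertex of the cycle is met by the edge that starts and by the edge that ends there; these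
  coincide only for a loop, which counts twice.\<close>

lemma leafless_cycle:
  assumes "is_cycle G vs es"
  shows "leafless G (set es)"
proof -
  define n where "n = length es"
  have len: "length vs = n" and n: "0 < n" and dist: "distinct vs" "distinct es"
    and ends: "\<And>i. i < n \<Longrightarrow> endpoints G (es ! i) = {#vs ! i, vs ! (Suc i mod n)#}"
    and sub: "set es \<subseteq> edges G"
    using assms unfolding is_cycle_def n_def by auto
  have deg: "deg_in G (set es) v \<noteq> 1" for v
  proof (cases "\<exists>e\<in>set es. v \<in># endpoints G e")
    case False
    then have "deg_in G (set es) v = 0" using deg_in_zero_iff[of "set es" G v] by simp
    then show ?thesis by simp
  next
    case True
    then obtain i0 where i0: "i0 < n" "v \<in># endpoints G (es ! i0)"
      unfolding n_def by (metis in_set_conv_nth)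
    then have "v = vs ! i0 \<or> v = vs ! (Suc i0 mod n)" using ends[OF i0(1)] by simp
    then obtain i where i: "i < n" "v = vs ! i" using n i0(1) by (metis mod_less_divisor)
    show ?thesis
    proof (cases "n = 1")
      case True
      then have "i = 0" "endpoints G (es ! 0) = {#v, v#}" using i ends[of 0] by auto
      moreover have "deg_in G {es ! 0} v \<le> deg_in G (set es) v"
        by (rule deg_in_mono) (use n n_def in auto)
      ultimately show ?thesis by (simp add: deg_in_def)
    next
      case False
      \<comment> \<open>The predecessor of \<open>i\<close> in cyclic order.\<close>
      define j where "j = (if i = 0 then n - 1 else i - 1)"
      have j: "j < n" "j \<noteq> i" "Suc j mod n = i" using i(1) False n by (auto simp: j_def)
      have "es ! i \<noteq> es ! j" using dist(2) j(1,2) i(1) by (simp add: nth_eq_iff_index_eq n_def)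
      then have "deg_in G {es ! i, es ! j} v = count (endpoints G (es ! i)) v + count (endpoints G (es ! j)) v"
        by (simp add: deg_in_def)
      also have "\<dots> \<ge> 2" using ends[OF i(1)] ends[OF j(1)] j(3) i(2) by simp
      also have "deg_in G {es ! i, es ! j} v \<le> deg_in G (set es) v"
        by (rule deg_in_mono) (use i j n_def in auto)
      finally show ?thesis by simp
    qed
  qed
  have "size (endpoints G e) = 2" if "e \<in> set es" for e
    using that ends unfolding in_set_conv_nth n_def by auto
  then show ?thesis unfolding leafless_def using deg sub n n_def by auto
qed

lemma tie_fighter_has_tie_partition:
  fixes G :: "('v, 'e, 'm) metric_graph_scheme"
  assumes "tie_fighter G"
  shows "has_tie_partition G"
proof -
  obtain a b e1 e2 e3 e2' e3' e4 and S :: "nat \<Rightarrow> ('v, 'e) metric_graph" where ab: "a \<in> verts G" "b \<in> verts G" "a \<noteq> b"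
    and S': "\<forall>i\<in>{1..4}. subgraph (S i) G \<and> connected_graph (S i) \<and> has_cycle (S i) \<and>
                    a \<notin> verts (S i) \<and> b \<notin> verts (S i)"
    and disj': "\<forall>i\<in>{1..4}. \<forall>j\<in>{1..4}. i \<noteq> j \<longrightarrow> verts (S i) \<inter> verts (S j) = {}"
    and J: "joins_to G e1 (S 1) a" "joins_to G e2 (S 2) a" "joins_to G e3 (S 3) a"
        "joins_to G e2' (S 2) b" "joins_to G e3' (S 3) b" "joins_to G e4 (S 4) b"
    and VG: "verts G = {a, b} \<union> (\<Union>i\<in>{1..4}. verts (S i))"
    and EG: "edges G = {e1, e2, e3, e2', e3', e4} \<union> (\<Union>i\<in>{1..4::nat}. edges (S i))"
    using assms unfolding tie_fighter_def by (elim exE conjE) (rule that; assumption)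
  note S = bspec[OF S'] and disj = disj'[rule_format]
  define L where "L i = (if i = 1 then L1 else if i = 2 then L2 else if i = 3 then L3 else L4)" for i :: nat
  define c where "c v = (if v = a then La else if v = b then Lb else L (THE i. i \<in> {1..4} \<and> v \<in> verts (S i)))" for v
  have cS: "c v = L i" if "i \<in> {1..4}" "v \<in> verts (S i)" for i v
  proof -
    have "(THE i. i \<in> {1..4} \<and> v \<in> verts (S i)) = i"
      by (rule the_equality) (use that disj in blast)+
    then show ?thesis using S[OF that(1)] that(2) by (auto simp: c_def)
  qed
  have cab: "c a = La" "c b = Lb" using ab by (auto simp: c_def)
  have L: "L 1 = L1" "L 2 = L2" "L 3 = L3" "L 4 = L4" by (auto simp: L_def)
  have L_surj: "\<exists>i\<in>{1..4}. p = L i" if "p \<in> blobs" for p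
  proof -
    have "p = L 1 \<or> p = L 2 \<or> p = L 3 \<or> p = L 4" using that L by (auto simp: blobs_def)
    then show ?thesis by (elim disjE) (rule bexI, assumption, simp)+
  qed
  have L_inj: "L i = L j \<longleftrightarrow> i = j" if "i \<in> {1..4}" "j \<in> {1..4}" for i j
    using that by (auto simp: L_def)
  have L_ab: "L i \<noteq> La" "L i \<noteq> Lb" for i by (auto simp: L_def)
  have blk: "{v\<in>verts G. c v = L i} = verts (S i)" if i: "i \<in> {1..4}" for i
  proof
    show "verts (S i) \<subseteq> {v\<in>verts G. c v = L i}" using cS[OF i] VG i by blast
    show "{v\<in>verts G. c v = L i} \<subseteq> verts (S i)"
    proof
      fix v assume v: "v \<in> {v\<in>verts G. c v = L i}"
      then have "v \<noteq> a" "v \<noteq> b" using cab L_ab by (metis (mono_tags) mem_Collect_eq)+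
      then obtain j where "j \<in> {1..4}" "v \<in> verts (S j)" using v VG by blast
      then show "v \<in> verts (S i)" using cS L_inj i v by auto
    qed
  qed
  have blk_ab: "{v\<in>verts G. c v = La} = {a}" "{v\<in>verts G. c v = Lb} = {b}"
  proof -
    have *: "v = a \<or> v = b \<or> c v \<noteq> La \<and> c v \<noteq> Lb" if "v \<in> verts G" for v
    proof -
      have "v = a \<or> v = b \<or> (\<exists>i\<in>{1..4}. v \<in> verts (S i))" using that unfolding VG by blast
      then show ?thesis using cS L_ab by auto
    qed
    then have "v = a" if "v \<in> verts G" "c v = La" for v using that cab by force
    then show "{v\<in>verts G. c v = La} = {a}" using ab cab by blast
    have "v = b" if "v \<in> verts G" "c v = Lb" for v using that cab * by force
    then show "{v\<in>verts G. c v = Lb} = {b}" using ab cab by blast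
  qed
  have eS: "endpoints G e = endpoints (S i) e" "set_mset (endpoints G e) \<subseteq> verts (S i)"
    if "i \<in> {1..4}" "e \<in> edges (S i)" for i e
  proof -
    have sub: "subgraph (S i) G" using S[OF that(1)] by blast
    then show "endpoints G e = endpoints (S i) e" using that(2) unfolding subgraph_def by simp
    then show "set_mset (endpoints G e) \<subseteq> verts (S i)"
      using endpoints_verts[of "S i" e] that(2) sub unfolding subgraph_def by auto
  qed
  have im: "image_mset c (endpoints G e) = {#L i, c v#}"
    if "joins_to G e (S i) v" "i \<in> {1..4}" for e i v
    using that cS unfolding joins_to_def by auto
  note ims = im[OF J(1)] im[OF J(2)] im[OF J(3)] im[OF J(4)] im[OF J(5)] im[OF J(6)]
  have imS: "image_mset c (endpoints G e) \<noteq> {#p, q#}" if "i \<in> {1..4}" "e \<in> edges (S i)" "p \<noteq> q" for i e p q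
  proof
    assume "image_mset c (endpoints G e) = {#p, q#}"
    then obtain x y where xy: "endpoints G e = {#x, y#}" "c x = p" "c y = q" by (rule image_mset_pair)
    then have "x \<in> verts (S i)" "y \<in> verts (S i)" using eS(2)[OF that(1,2)] by auto
    then show False using cS[OF that(1)] xy that(3) by auto
  qed
  have "tie_partition G c"
    unfolding tie_partition_def
  proof (intro conjI allI ballI impI)
    fix p
    consider i where "i \<in> {1..4}" "p = L i" | "p = La" | "p = Lb"
      using L_surj[of p] by (cases p) (auto simp: blobs_def)
    then show "cut_connected (adj G) {v\<in>verts G. c v = p}"
    proof cases
      case 1
      have "cut_connected (adj (S i)) (verts (S i))"
        using cut_connected_connected_graph S[OF 1(1)] unfolding subgraph_def by blast
      moreover have "adj G x y" if "adj (S i) x y" for x y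
        using that S[OF 1(1)] unfolding adj_def subgraph_def by (metis subsetD)
      ultimately show ?thesis unfolding 1(2) blk[OF 1(1)] cut_connected_def by meson
    qed (auto simp: blk_ab cut_connected_def)
  next
    fix M assume "M \<in> joined"
    then have M: "M \<in> {{#L1, La#}, {#L2, La#}, {#L3, La#}, {#L2, Lb#}, {#L3, Lb#}, {#L4, Lb#}}"
      unfolding joined_def .
    \<comment> \<open>Edges inside a blob carry equal labels, so only the six joining edges can have label \<open>M\<close>.\<close>
    have notS: "image_mset c (endpoints G e) \<noteq> M" if "i \<in> {1..4}" "e \<in> edges (S i)" for i e
      using imS[OF that] M by auto
    have six: "image_mset c (endpoints G e1) = {#L1, La#}" "image_mset c (endpoints G e2) = {#L2, La#}"
      "image_mset c (endpoints G e3) = {#L3, La#}" "image_mset c (endpoints G e2') = {#L2, Lb#}"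
      "image_mset c (endpoints G e3') = {#L3, Lb#}" "image_mset c (endpoints G e4) = {#L4, Lb#}"
      using ims cab L by auto
    have "(e \<in> edges G \<and> image_mset c (endpoints G e) = M) \<longleftrightarrow>
      e \<in> {e1, e2, e3, e2', e3', e4} \<and> image_mset c (endpoints G e) = M" for e
      using EG notS by blast
    moreover have "\<exists>!e. e \<in> {e1, e2, e3, e2', e3', e4} \<and> image_mset c (endpoints G e) = M"
    proof (rule ex_ex1I)
      show "\<exists>e. e \<in> {e1, e2, e3, e2', e3', e4} \<and> image_mset c (endpoints G e) = M"
        using M six by (elim insertE emptyE) blast+
      fix e f
      assume "e \<in> {e1, e2, e3, e2', e3', e4} \<and> image_mset c (endpoints G e) = M"
        and "f \<in> {e1, e2, e3, e2', e3', e4} \<and> image_mset c (endpoints G f) = M"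
      then have "e \<in> {e1, e2, e3, e2', e3', e4}" "f \<in> {e1, e2, e3, e2', e3', e4}"
        "image_mset c (endpoints G e) = image_mset c (endpoints G f)" by auto
      then show "e = f"
        by (elim insertE emptyE) (simp_all add: six mset_pair_eq)
    qed
    ultimately show "\<exists>!e. e \<in> edges G \<and> image_mset c (endpoints G e) = M" by simp
  next
    fix e x y assume e: "e \<in> edges G" "endpoints G e = {#x, y#}" "c x \<noteq> c y"
    have "image_mset c (endpoints G e) = {#c x, c y#}" using e by simp
    moreover have "e \<in> {e1, e2, e3, e2', e3', e4}"
      using imS[OF _ _ e(3)] e(1) calculation EG by blast
    ultimately show "{#c x, c y#} \<in> joined"
      using ims cab L unfolding joined_def by auto
  next
    fix p assume "p \<in> blobs"
    then obtain i where i: "i \<in> {1..4}" "p = L i"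
      using L_surj by blast
    obtain vs es where "is_cycle (S i) vs es" using S[OF i(1)] unfolding has_cycle_def by blast
    then have F: "leafless (S i) (set es)" by (rule leafless_cycle)
    then have sub: "set es \<subseteq> edges (S i)" unfolding leafless_def by blast
    then have same: "endpoints G e = endpoints (S i) e" if "e \<in> set es" for e using eS(1)[OF i(1)] that by blast
    have "deg_in G (set es) v = deg_in (S i) (set es) v" for v
      unfolding deg_in_def by (intro sum.cong refl) (simp add: same)
    then have "leafless G (set es)"
      using F same S[OF i(1)] sub unfolding leafless_def subgraph_def by auto
    moreover have "\<forall>e\<in>set es. \<forall>v\<in>#endpoints G e. c v = p"
      using eS(2)[OF i(1)] sub cS[OF i(1)] i(2) by blast
    ultimately show "\<exists>F. leafless G F \<and> (\<forall>e\<in>F. \<forall>v\<in>#endpoints G e. c v = p)" by blast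
  qed
  then show ?thesis unfolding has_tie_partition_def by blast
qed

section \<open>Functions of degree three on a line\<close>

text \<open>What remains of a degree 3 cover of a path: vertices have heights and multiplicities \<open>m\<close>, and the
  edges in \<open>U\<close>, with slopes \<open>s\<close>, climb by one from \<open>lo e\<close> to \<open>hi e\<close>. Harmonicity says that the slopes
  above and below \<open>v\<close> both add up to \<open>m v\<close>, as long as the path continues in that direction; the
  vertex \<open>u\<close> in the hypotheses only witnesses this.\<close>

locale layering =
  fixes V :: "'v set" and h :: "'v \<Rightarrow> int" and U :: "'e set" and lo hi :: "'e \<Rightarrow> 'v"
    and s :: "'e \<Rightarrow> nat" and m :: "'v \<Rightarrow> nat"
  assumes finite_V: "finite V" and finite_U: "finite U"
    and lo_in: "e \<in> U \<Longrightarrow> lo e \<in> V" and hi_in: "e \<in> U \<Longrightarrow> hi e \<in> V"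
    and h_hi: "e \<in> U \<Longrightarrow> h (hi e) = h (lo e) + 1"
    and up_sum: "\<lbrakk>v \<in> V; u \<in> V; h v < h u\<rbrakk> \<Longrightarrow> (\<Sum>e | e \<in> U \<and> lo e = v. s e) = m v"
    and down_sum: "\<lbrakk>v \<in> V; u \<in> V; h u < h v\<rbrakk> \<Longrightarrow> (\<Sum>e | e \<in> U \<and> hi e = v. s e) = m v"
    and m_pos: "v \<in> V \<Longrightarrow> 0 < m v"
    and fibre_degree: "(\<Sum>v | v \<in> V \<and> h v = k. m v) \<le> 3"
begin

text \<open>Lets every statement about going up be used for going down.\<close>

lemma reflection: "layering V (\<lambda>v. - h v) U hi lo s m"
proof
  show "(\<Sum>v | v \<in> V \<and> - h v = k. m v) \<le> 3" for k
    using fibre_degree[of "- k"] by (simp add: minus_equation_iff[of _ k] eq_commute[of "- k"])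
qed (use finite_V finite_U lo_in hi_in h_hi up_sum down_sum m_pos in auto)

definition weight :: "'v set \<Rightarrow> int \<Rightarrow> nat" where
  "weight X k = (\<Sum>v | v \<in> V \<and> v \<in> X \<and> h v = k. m v)"

lemma weight_mono: "X \<subseteq> Y \<Longrightarrow> weight X k \<le> weight Y k"
  unfolding weight_def by (rule sum_mono2) (use finite_V in auto)

lemma weight_le: "weight X k \<le> 3"
  using weight_mono[of X UNIV k] fibre_degree[of k] unfolding weight_def by simp

lemma weight_Un:
  assumes "X \<inter> Y = {}" shows "weight (X \<union> Y) k = weight X k + weight Y k"
proof -
  have "{v \<in> V. v \<in> X \<union> Y \<and> h v = k} = {v \<in> V. v \<in> X \<and> h v = k} \<union> {v \<in> V. v \<in> Y \<and> h v = k}"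
    by blast
  then show ?thesis
    unfolding weight_def using assms finite_V by (simp add: sum.union_disjoint disjoint_iff)
qed

lemma weight_pos:
  assumes "v \<in> V" "v \<in> X" shows "1 \<le> weight X (h v)"
proof -
  have "m v \<le> weight X (h v)"
    unfolding weight_def by (rule member_le_sum) (use assms finite_V in auto)
  then show ?thesis using m_pos[OF assms(1)] by linarith
qed

lemma weight_nonzero: "1 \<le> weight X k \<Longrightarrow> \<exists>v\<in>V. v \<in> X \<and> h v = k"
proof (rule ccontr)
  assume *: "1 \<le> weight X k" "\<not> (\<exists>v\<in>V. v \<in> X \<and> h v = k)"
  then have "{v. v \<in> V \<and> v \<in> X \<and> h v = k} = {}" by blast
  then show False using *(1) unfolding weight_def by (metis not_one_le_zero sum.empty)
qed

lemma sum_lo: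
  assumes "u \<in> V" "k < h u"
  shows "(\<Sum>e | e \<in> U \<and> h (lo e) = k \<and> lo e \<in> X. s e) = weight X k"
proof -
  let ?A = "{v. v \<in> V \<and> v \<in> X \<and> h v = k}"
  have "weight X k = (\<Sum>v\<in>?A. \<Sum>e | e \<in> U \<and> lo e = v. s e)"
    unfolding weight_def by (intro sum.cong refl) (use up_sum assms in auto)
  also have "\<dots> = (\<Sum>e\<in>(\<Union>v\<in>?A. {e. e \<in> U \<and> lo e = v}). s e)"
    by (rule sum.UNION_disjoint[symmetric]) (use finite_V finite_U in auto)
  also have "(\<Union>v\<in>?A. {e. e \<in> U \<and> lo e = v}) = {e. e \<in> U \<and> h (lo e) = k \<and> lo e \<in> X}"
    using lo_in by auto
  finally show ?thesis by simp
qed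

end

lemma (in layering) sum_hi:
  assumes "u \<in> V" "h u < k"
  shows "(\<Sum>e | e \<in> U \<and> h (hi e) = k \<and> hi e \<in> X. s e) = weight X k"
proof -
  interpret r: layering V "\<lambda>v. - h v" U hi lo s m by (rule reflection)
  have "r.weight X (- k) = weight X k"
    unfolding weight_def r.weight_def by simp
  then show ?thesis using r.sum_lo[of u "- k" X] assms by simp
qed

context layering
begin

text \<open>Multiplicity at least 2 starts upwards in \<open>X\<close> at height \<open>q\<close>. As long as no edge leaves \<open>S\<close>, it stays in
  \<open>S\<close> and does not decrease. Just below height \<open>r\<close>, however, edges of total slope at least 2 out of 3
  arrive in \<open>Y\<close>, outside \<open>S\<close>; so some edge does leave \<open>S\<close>. The last two conjuncts say that the edge meets the
  two extreme heights only in \<open>X\<close> and in \<open>Y\<close>: this makes its ends outside \<open>X\<close> and \<open>Y\<close> lie strictly between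
  \<open>q\<close> and \<open>r\<close>.\<close>

lemma up_crossing:
  assumes qr: "q < r" and X: "2 \<le> weight X q" and Y: "2 \<le> weight Y r"
    and S: "X \<subseteq> S" "Y \<inter> S = {}"
  shows "\<exists>e\<in>U. lo e \<in> S \<and> hi e \<notin> S \<and> q \<le> h (lo e) \<and> h (hi e) \<le> r \<and>
           (h (lo e) = q \<longrightarrow> lo e \<in> X) \<and> (h (hi e) = r \<longrightarrow> hi e \<in> Y)"
proof (rule ccontr)
  assume "\<not> ?thesis"
  then have none: "hi e \<in> S \<and> h (hi e) < r \<or> hi e \<notin> Y \<and> h (hi e) = r"
    if "e \<in> U" "lo e \<in> S" "q \<le> h (lo e)" "h (lo e) < r" "h (lo e) = q \<longrightarrow> lo e \<in> X" for e
    using that h_hi[of e] S by fastforce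
  obtain x where x: "x \<in> V" "h x = q" using weight_nonzero[of X q] X by auto
  obtain y where y: "y \<in> V" "h y = r" using weight_nonzero[of Y r] Y by auto
  \<comment> \<open>The set through which the flow from \<open>X\<close> passes: at the lowest height only \<open>X\<close> is controlled.\<close>
  define S' where "S' k = (if k = q then X else S)" for k
  have S': "S' k \<subseteq> S" for k using S by (simp add: S'_def)
  have "q \<le> k \<Longrightarrow> k < r \<longrightarrow> 2 \<le> weight (S' k) k" for k
  proof (induction k rule: int_ge_induct)
    case base
    show ?case using X by (simp add: S'_def)
  next
    case (step k)
    show ?case
    proof
      assume k: "k + 1 < r"
      have "weight (S' k) k = (\<Sum>e | e \<in> U \<and> h (lo e) = k \<and> lo e \<in> S' k. s e)"
        by (rule sum_lo[symmetric, OF y(1)]) (use k y in auto)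
      also have "\<dots> \<le> (\<Sum>e | e \<in> U \<and> h (hi e) = k + 1 \<and> hi e \<in> S. s e)"
      proof (rule sum_mono2)
        show "{e. e \<in> U \<and> h (lo e) = k \<and> lo e \<in> S' k} \<subseteq> {e. e \<in> U \<and> h (hi e) = k + 1 \<and> hi e \<in> S}"
        proof safe
          fix e assume e: "e \<in> U" "lo e \<in> S' (h (lo e))" "k = h (lo e)"
          show "h (hi e) = h (lo e) + 1" using h_hi[OF e(1)] .
          have "hi e \<in> S \<and> h (hi e) < r \<or> hi e \<notin> Y \<and> h (hi e) = r"
            by (rule none) (use e step.hyps k S' in \<open>auto simp: S'_def\<close>)
          then show "hi e \<in> S" using k e h_hi[OF e(1)] by auto
        qed
      qed (use finite_U in auto)
      also have "\<dots> = weight S (k + 1)"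
        by (rule sum_hi[OF x(1)]) (use x step.hyps in auto)
      finally show "2 \<le> weight (S' (k + 1)) (k + 1)"
        using step k by (simp add: S'_def)
    qed
  qed
  from this[of "r - 1"] have "2 \<le> weight (S' (r - 1)) (r - 1)" using qr by simp
  also have "weight (S' (r - 1)) (r - 1) =
      (\<Sum>e | e \<in> U \<and> h (lo e) = r - 1 \<and> lo e \<in> S' (r - 1). s e)" (is "_ = sum s ?A")
    by (rule sum_lo[symmetric, OF y(1)]) (use y in auto)
  finally have A: "2 \<le> sum s ?A" .
  have B: "2 \<le> (\<Sum>e | e \<in> U \<and> h (hi e) = r \<and> hi e \<in> Y. s e)" (is "_ \<le> sum s ?B")
    using Y sum_hi[OF x(1), of r Y] x qr by simp
  \<comment> \<open>An edge in both sets would be a crossing; disjointness gives total slope 4 over one edge of the path.\<close>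
  have "?A \<inter> ?B = {}"
  proof (rule ccontr)
    assume "?A \<inter> ?B \<noteq> {}"
    then obtain e where e: "e \<in> U" "h (lo e) = r - 1" "lo e \<in> S' (r - 1)" "hi e \<in> Y" "h (hi e) = r"
      by blast
    have "hi e \<in> S \<and> h (hi e) < r \<or> hi e \<notin> Y \<and> h (hi e) = r"
      by (rule none) (use e qr S' in \<open>auto simp: S'_def\<close>)
    then show False using e by auto
  qed
  then have "sum s ?A + sum s ?B = sum s (?A \<union> ?B)"
    using finite_U by (simp add: sum.union_disjoint)
  also have "\<dots> \<le> (\<Sum>e | e \<in> U \<and> h (hi e) = r \<and> hi e \<in> UNIV. s e)"
    by (rule sum_mono2) (use finite_U h_hi in auto)
  also have "\<dots> = weight UNIV r"
    by (rule sum_hi[OF x(1)]) (use x qr in auto)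
  finally show False using A B weight_le[of UNIV r] by linarith
qed

lemma no_two_beside:
  assumes "2 \<le> weight X k" "x \<in> V" "y \<in> V" "h x = k" "h y = k" "x \<noteq> y" "x \<notin> X" "y \<notin> X"
  shows False
proof -
  have "weight (X \<union> ({x} \<union> {y})) k = weight X k + (weight {x} k + weight {y} k)"
    using assms by (subst weight_Un, simp, subst weight_Un, simp_all)
  then show False
    using weight_le[of "X \<union> ({x} \<union> {y})" k] weight_pos[of x "{x}"] weight_pos[of y "{y}"] assms
    by simp
qed

end

text \<open>A layering together with a partition in the shape of a TIE-fighter. The relation \<open>R\<close> contains all
  edges, contracted ones included, hence the inequality in \<open>step\<close>; the joints are required to be unique
  only among climbing edges. The height \<open>q p\<close> is one at which the blob \<open>p\<close> occupies at least two of the three sheets.\<close>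

locale tie_layering = layering V h U lo hi s m
  for V :: "'v set" and h :: "'v \<Rightarrow> int" and U :: "'e set" and lo hi s m +
  fixes R :: "'v \<Rightarrow> 'v \<Rightarrow> bool" and c :: "'v \<Rightarrow> part" and q :: "part \<Rightarrow> int"
  assumes sym_R: "symp R"
    and step: "R x y \<Longrightarrow> \<bar>h x - h y\<bar> \<le> 1"
    and conn: "cut_connected R {v\<in>V. c v = p}"
    and join: "{#p, p'#} \<in> joined \<Longrightarrow> \<exists>x\<in>V. \<exists>y\<in>V. c x = p \<and> c y = p' \<and> R x y"
    and cross: "e \<in> U \<Longrightarrow> c (lo e) \<noteq> c (hi e) \<Longrightarrow> {#c (lo e), c (hi e)#} \<in> joined"
    and unique: "\<lbrakk>e \<in> U; f \<in> U; c (lo e) \<noteq> c (hi e); {#c (lo e), c (hi e)#} = {#c (lo f), c (hi f)#}\<rbrakk>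
                  \<Longrightarrow> e = f"
    and heavy: "p \<in> blobs \<Longrightarrow> 2 \<le> weight {v. c v = p} (q p)"
begin

lemma reflection_tie: "tie_layering V (\<lambda>v. - h v) U hi lo s m R c (\<lambda>p. - q p)"
proof -
  interpret r: layering V "\<lambda>v. - h v" U hi lo s m by (rule reflection)
  have w: "r.weight X (- k) = weight X k" for X k
    unfolding weight_def r.weight_def by simp
  show ?thesis
  proof
    show "\<bar>- h x - - h y\<bar> \<le> 1" if "R x y" for x y using step[OF that] by linarith
    show "{#c (hi e), c (lo e)#} \<in> joined" if "e \<in> U" "c (hi e) \<noteq> c (lo e)" for e
      using cross[OF that(1)] that(2) by (simp add: add_mset_commute)
    show "e = f" if "e \<in> U" "f \<in> U" "c (hi e) \<noteq> c (lo e)"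
      "{#c (hi e), c (lo e)#} = {#c (hi f), c (lo f)#}" for e f
      using unique[OF that(1,2)] that(3,4) by (simp add: add_mset_commute)
    show "2 \<le> r.weight {v. c v = p} (- q p)" if "p \<in> blobs" for p
      using heavy[OF that] by (simp add: w)
  qed (use sym_R conn join in auto)
qed

text \<open>Reduces the orders of the four heights to one by the symmetries of the pattern.\<close>

lemma relabel_tie:
  assumes t: "\<And>p. t (t p) = p" and J: "\<And>p p'. {#t p, t p'#} \<in> joined \<longleftrightarrow> {#p, p'#} \<in> joined"
    and b: "\<And>p. t p \<in> blobs \<longleftrightarrow> p \<in> blobs"
  shows "tie_layering V h U lo hi s m R (\<lambda>v. t (c v)) (\<lambda>p. q (t p))"
proof
  have eq: "t x = y \<longleftrightarrow> x = t y" for x y using t by metis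
  show "cut_connected R {v \<in> V. t (c v) = p}" for p using conn[of "t p"] by (simp add: eq)
  show "\<exists>x\<in>V. \<exists>y\<in>V. t (c x) = p \<and> t (c y) = p' \<and> R x y" if "{#p, p'#} \<in> joined" for p p'
    using join[of "t p" "t p'"] that J by (simp add: eq)
  show "{#t (c (lo e)), t (c (hi e))#} \<in> joined" if "e \<in> U" "t (c (lo e)) \<noteq> t (c (hi e))" for e
    using cross[OF that(1)] that(2) J by metis
  show "e = f" if "e \<in> U" "f \<in> U" "t (c (lo e)) \<noteq> t (c (hi e))"
      "{#t (c (lo e)), t (c (hi e))#} = {#t (c (lo f)), t (c (hi f))#}" for e f
  proof (rule unique[OF that(1,2)])
    show "c (lo e) \<noteq> c (hi e)" using that(3) by auto
    have "image_mset t {#t (c (lo e)), t (c (hi e))#} = image_mset t {#t (c (lo f)), t (c (hi f))#}"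
      using that(4) by (rule arg_cong)
    then show "{#c (lo e), c (hi e)#} = {#c (lo f), c (hi f)#}" by (simp add: t)
  qed
  show "2 \<le> weight {v. t (c v) = p} (q (t p))" if "p \<in> blobs" for p
    using heavy[of "t p"] that b by (simp add: eq)
qed (use sym_R step in auto)

text \<open>The intermediate value property, obtained by cutting \<open>W\<close> just below height \<open>k\<close>.\<close>

lemma passes_height:
  assumes W: "cut_connected R W" and "x \<in> W" "h x < k" "y \<in> W" "k < h y"
  shows "\<exists>z\<in>W. h z = k"
proof -
  have "y \<notin> {v\<in>W. h v < k}" using assms by simp
  then obtain u v where "u \<in> {v\<in>W. h v < k}" "v \<in> W - {v\<in>W. h v < k}" "R u v"
    using cut_connectedE[OF W, of "{v\<in>W. h v < k}"] assms by blast
  then show ?thesis using step[of u v] by (intro bexI[of _ v]) auto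
qed

lemma joined_connected:
  assumes "{#p, p'#} \<in> joined" "cut_connected R W" "{v\<in>V. c v = p'} \<subseteq> W"
  shows "cut_connected R ({v\<in>V. c v = p} \<union> W)"
proof -
  obtain x y where "x \<in> V" "y \<in> V" "c x = p" "c y = p'" "R x y"
    using join[OF assms(1)] by blast
  then show ?thesis
    using assms by (intro cut_connected_Un[OF conn assms(2) sym_R, of x _ y]) auto
qed

lemma heavy_vertex: "p \<in> blobs \<Longrightarrow> \<exists>v\<in>V. c v = p \<and> h v = q p"
  using weight_nonzero[of "{v. c v = p}" "q p"] heavy[of p] by auto

lemma q_inj:
  assumes "p \<in> blobs" "p' \<in> blobs" "p \<noteq> p'" shows "q p \<noteq> q p'"
proof
  assume eq: "q p = q p'"
  have "weight ({v. c v = p} \<union> {v. c v = p'}) (q p) = weight {v. c v = p} (q p) + weight {v. c v = p'} (q p)"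
    by (rule weight_Un) (use assms in auto)
  then show False
    using weight_le[of "{v. c v = p} \<union> {v. c v = p'}" "q p"] heavy[of p] heavy[of p'] assms eq by simp
qed

text \<open>The connection from blob \<open>i\<close> up to blob 1 ends with the only joint of blob 1, so \<open>La\<close> has a vertex below
  \<open>q L1\<close>. Then \<open>La\<close> with blob \<open>k\<close>, and blob \<open>i\<close> with \<open>Lb\<close> and blob \<open>l\<close>, both pass height \<open>q L1\<close>,
  where there is room for one vertex only besides blob 1. The blob \<open>k\<close> must be one that is joined to
  \<open>La\<close>, which excludes 4.\<close>

lemma blob1_not_second:
  assumes ikl: "(i, k, l) \<in> {(L2, L3, L4), (L3, L2, L4), (L4, L2, L3)}"
    and less: "q i < q L1" "q L1 < q k" "q L1 < q l"
  shows False
proof -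
  have mem: "k \<in> {L2, L3}" "i \<in> {L2, L3, L4}" "l \<in> {L2, L3, L4}" "i \<noteq> k" "i \<noteq> l" "k \<noteq> l"
    using ikl by auto
  then have blob: "i \<in> blobs" "k \<in> blobs" "l \<in> blobs" "L1 \<in> blobs"
    by (auto simp: blobs_def)
  have "\<exists>e\<in>U. lo e \<in> {v. c v \<noteq> L1} \<and> hi e \<notin> {v. c v \<noteq> L1} \<and> q i \<le> h (lo e) \<and> h (hi e) \<le> q L1 \<and>
           (h (lo e) = q i \<longrightarrow> lo e \<in> {v. c v = i}) \<and> (h (hi e) = q L1 \<longrightarrow> hi e \<in> {v. c v = L1})"
    by (rule up_crossing[OF less(1) heavy heavy]) (use blob mem in auto)
  then obtain e where e: "e \<in> U" "c (lo e) \<noteq> L1" "c (hi e) = L1" "h (hi e) \<le> q L1"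
    by auto
  then have a: "c (lo e) = La" "h (lo e) < q L1"
    using cross[OF e(1)] h_hi[OF e(1)] by (auto simp: joined_iff)
  obtain zi zk zl where z: "zi \<in> V" "c zi = i" "h zi = q i" "zk \<in> V" "c zk = k" "h zk = q k"
      "zl \<in> V" "c zl = l" "h zl = q l"
    using heavy_vertex blob by metis
  \<comment> \<open>The two disjoint connected sets that pass height \<open>q L1\<close>.\<close>
  have "cut_connected R ({v\<in>V. c v = k} \<union> {v\<in>V. c v = La})"
    by (rule joined_connected[of k La, OF _ conn]) (use mem in \<open>auto simp: joined_iff\<close>)
  then have "\<exists>x\<in>{v\<in>V. c v = k} \<union> {v\<in>V. c v = La}. h x = q L1"
    by (rule passes_height[of _ "lo e" _ zk]) (use a z less lo_in[OF e(1)] in auto)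
  moreover have "cut_connected R ({v\<in>V. c v = i} \<union> ({v\<in>V. c v = l} \<union> {v\<in>V. c v = Lb}))"
    by (rule joined_connected[of i Lb, OF _ joined_connected[of l Lb, OF _ conn]])
      (use mem in \<open>auto simp: joined_iff\<close>)
  then have "\<exists>y\<in>{v\<in>V. c v = i} \<union> ({v\<in>V. c v = l} \<union> {v\<in>V. c v = Lb}). h y = q L1"
    by (rule passes_height[of _ zi _ zl]) (use z less in auto)
  ultimately obtain x y where xy: "x \<in> V" "c x \<in> {k, La}" "h x = q L1"
      "y \<in> V" "c y \<in> {i, l, Lb}" "h y = q L1"
    by auto
  have "c x \<noteq> c y" using xy mem by auto
  then have "x \<noteq> y" by metis
  moreover have "c x \<noteq> L1" "c y \<noteq> L1" using xy mem by auto
  ultimately show False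
    using no_two_beside[OF heavy[OF blob(4)] xy(1,4,3,6)] by simp
qed

text \<open>Here blobs 2 and 3 are linked by two routes, through \<open>La\<close> and through \<open>Lb\<close>. Whichever of them is used
  between heights \<open>q L2\<close> and \<open>q L3\<close> has both its joints attached there. The connection between blobs 1
  and 2, respectively 3 and 4, would need one of the same two joints attached below \<open>q L2\<close>,
  respectively above \<open>q L3\<close>.\<close>

lemma not_in_order_1234:
  assumes less: "q L1 < q L2" "q L2 < q L3" "q L3 < q L4"
  shows False
proof -
  have blob: "L1 \<in> blobs" "L2 \<in> blobs" "L3 \<in> blobs" "L4 \<in> blobs"
    by (auto simp: blobs_def)
  \<comment> \<open>The edge joining the parts \<open>p\<close> and \<open>p'\<close> has its end in \<open>p'\<close> strictly between blobs 2 and 3.\<close>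
  define meets where "meets p p' \<longleftrightarrow> (\<exists>e\<in>U. \<exists>x. {#c (lo e), c (hi e)#} = {#p, p'#} \<and>
     x \<in> {lo e, hi e} \<and> c x = p' \<and> q L2 < h x \<and> h x < q L3)" for p p'
  have meetsI: "meets p p'" if "e \<in> U" "{#c (lo e), c (hi e)#} = {#p, p'#}" "x \<in> {lo e, hi e}"
      "c x = p'" "q L2 < h x" "h x < q L3" for e x p p'
    using that unfolding meets_def by blast
  have "meets L2 La \<and> meets L3 La \<or> meets L2 Lb \<and> meets L3 Lb"
  proof (rule ccontr)
    assume no: "\<not> ?thesis"
    \<comment> \<open>The parts that can be reached from blob 2 using only ends that lie between; by \<open>no\<close>, blob 3 is not among them, and no climbing edge leaves them between the two heights.\<close>
    let ?P = "insert L2 ((if meets L2 La then {La, L1} else {}) \<union> (if meets L2 Lb then {Lb, L4} else {}))"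
    have "\<exists>e\<in>U. lo e \<in> {v. c v \<in> ?P} \<and> hi e \<notin> {v. c v \<in> ?P} \<and> q L2 \<le> h (lo e) \<and> h (hi e) \<le> q L3 \<and>
           (h (lo e) = q L2 \<longrightarrow> lo e \<in> {v. c v = L2}) \<and> (h (hi e) = q L3 \<longrightarrow> hi e \<in> {v. c v = L3})"
      by (rule up_crossing[OF less(2) heavy heavy]) (use blob in auto)
    then obtain e where e: "e \<in> U" "c (lo e) \<in> ?P" "c (hi e) \<notin> ?P" "q L2 \<le> h (lo e)" "h (hi e) \<le> q L3"
        "h (lo e) = q L2 \<Longrightarrow> c (lo e) = L2" "h (hi e) = q L3 \<Longrightarrow> c (hi e) = L3"
      by blast
    have j: "{#c (lo e), c (hi e)#} \<in> joined" by (rule cross[OF e(1)]) (use e in metis)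
    have up: "meets (c (lo e)) (c (hi e))" if "c (hi e) \<noteq> L3"
      by (rule meetsI[OF e(1) refl, of "hi e"]) (use that e h_hi[OF e(1)] in force)+
    have down: "meets (c (hi e)) (c (lo e))" if "c (lo e) \<noteq> L2"
      by (rule meetsI[OF e(1) add_mset_commute, of "lo e"]) (use that e h_hi[OF e(1)] in force)+
    show False
      using j e(2,3) up down no by (auto simp: joined_iff split: if_splits)
  qed
  then show False
  proof (elim disjE conjE)
    assume m: "meets L2 La" "meets L3 La"
    have "\<exists>e\<in>U. lo e \<in> {v. c v \<in> {L1, La}} \<and> hi e \<notin> {v. c v \<in> {L1, La}} \<and> q L1 \<le> h (lo e) \<and> h (hi e) \<le> q L2 \<and>
           (h (lo e) = q L1 \<longrightarrow> lo e \<in> {v. c v = L1}) \<and> (h (hi e) = q L2 \<longrightarrow> hi e \<in> {v. c v = L2})"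
      by (rule up_crossing[OF less(1) heavy heavy]) (use blob in auto)
    then obtain e where e: "e \<in> U" "c (lo e) \<in> {L1, La}" "c (hi e) \<notin> {L1, La}" "h (hi e) \<le> q L2"
      by auto
    then have j: "c (lo e) = La" "c (hi e) = L2 \<or> c (hi e) = L3"
      using cross[OF e(1)] by (auto simp: joined_iff)
    then have "meets (c (hi e)) La" using m by auto
    then obtain f x where f: "f \<in> U" "{#c (lo f), c (hi f)#} = {#c (hi e), La#}"
        "x \<in> {lo f, hi f}" "c x = La" "q L2 < h x"
      unfolding meets_def by blast
    have "e = f" by (rule unique) (use e f j in \<open>auto simp: add_mset_commute\<close>)
    then show False using f e j h_hi[OF e(1)] by auto
  next
    assume m: "meets L2 Lb" "meets L3 Lb"
    have "\<exists>e\<in>U. lo e \<in> {v. c v \<notin> {L4, Lb}} \<and> hi e \<notin> {v. c v \<notin> {L4, Lb}} \<and> q L3 \<le> h (lo e) \<and> h (hi e) \<le> q L4 \<and>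
           (h (lo e) = q L3 \<longrightarrow> lo e \<in> {v. c v = L3}) \<and> (h (hi e) = q L4 \<longrightarrow> hi e \<in> {v. c v = L4})"
      by (rule up_crossing[OF less(3) heavy heavy]) (use blob in auto)
    then obtain e where e: "e \<in> U" "c (lo e) \<notin> {L4, Lb}" "c (hi e) \<in> {L4, Lb}" "q L3 \<le> h (lo e)"
      by auto
    then have j: "c (hi e) = Lb" "c (lo e) = L2 \<or> c (lo e) = L3"
      using cross[OF e(1)] by (auto simp: joined_iff)
    then have "meets (c (lo e)) Lb" using m by auto
    then obtain f x where f: "f \<in> U" "{#c (lo f), c (hi f)#} = {#c (lo e), Lb#}"
        "x \<in> {lo f, hi f}" "c x = Lb" "h x < q L3"
      unfolding meets_def by blast
    have "e = f" by (rule unique) (use e f j in auto)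
    then show False using f e j h_hi[OF e(1)] by auto
  qed
qed

end

fun swap23 :: "part \<Rightarrow> part" where
  "swap23 L2 = L3" | "swap23 L3 = L2" | "swap23 p = p"

fun swap14 :: "part \<Rightarrow> part" where
  "swap14 L1 = L4" | "swap14 L4 = L1" | "swap14 La = Lb" | "swap14 Lb = La" | "swap14 p = p"

context tie_layering
begin

lemma swap23_tie: "tie_layering V h U lo hi s m R (\<lambda>v. swap23 (c v)) (\<lambda>p. q (swap23 p))"
proof (rule relabel_tie)
  show "swap23 (swap23 p) = p" for p by (cases p) auto
  show "{#swap23 p, swap23 p'#} \<in> joined \<longleftrightarrow> {#p, p'#} \<in> joined" for p p'
    by (cases p; cases p') (simp_all add: joined_iff)
  show "swap23 p \<in> blobs \<longleftrightarrow> p \<in> blobs" for p by (cases p) (simp_all add: blobs_def)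
qed

lemma swap14_tie: "tie_layering V h U lo hi s m R (\<lambda>v. swap14 (c v)) (\<lambda>p. q (swap14 p))"
proof (rule relabel_tie)
  show "swap14 (swap14 p) = p" for p by (cases p) auto
  show "{#swap14 p, swap14 p'#} \<in> joined \<longleftrightarrow> {#p, p'#} \<in> joined" for p p'
    by (cases p; cases p') (simp_all add: joined_iff)
  show "swap14 p \<in> blobs \<longleftrightarrow> p \<in> blobs" for p by (cases p) (simp_all add: blobs_def)
qed

text \<open>The exclusion applied to the layering and to its reflection: there is neither exactly one blob
  below blob 1 nor exactly one above it.\<close>

lemma blob1_at_end:
  "(\<forall>p\<in>{L2, L3, L4}. q L1 < q p) \<or> (\<forall>p\<in>{L2, L3, L4}. q p < q L1)"
proof -
  interpret r: tie_layering V "\<lambda>v. - h v" U hi lo s m R c "\<lambda>p. - q p" by (rule reflection_tie)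
  have "q L1 \<noteq> q L2" "q L1 \<noteq> q L3" "q L1 \<noteq> q L4"
    by (rule q_inj; simp add: blobs_def)+
  moreover have "\<not> (q L2 < q L1 \<and> q L1 < q L3 \<and> q L1 < q L4)" "\<not> (q L3 < q L1 \<and> q L1 < q L2 \<and> q L1 < q L4)"
      "\<not> (q L4 < q L1 \<and> q L1 < q L2 \<and> q L1 < q L3)"
    using blob1_not_second[of L2 L3 L4] blob1_not_second[of L3 L2 L4] blob1_not_second[of L4 L2 L3]
    by (simp_all, blast+)
  moreover have "\<not> (q L2 > q L1 \<and> q L1 > q L3 \<and> q L1 > q L4)" "\<not> (q L3 > q L1 \<and> q L1 > q L2 \<and> q L1 > q L4)"
      "\<not> (q L4 > q L1 \<and> q L1 > q L2 \<and> q L1 > q L3)"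
    using r.blob1_not_second[of L2 L3 L4] r.blob1_not_second[of L3 L2 L4] r.blob1_not_second[of L4 L2 L3]
    by (simp_all, blast+)
  ultimately show ?thesis
    by (cases "q L1 < q L2"; cases "q L1 < q L3"; cases "q L1 < q L4") auto
qed

lemma no_tie_layering: False
proof -
  have order: "\<not> (q L1 < q L2 \<and> q L2 < q L3 \<and> q L3 < q L4)"
    by (intro notI; elim conjE; rule not_in_order_1234)
  have order': "\<not> (q L1 < q L3 \<and> q L3 < q L2 \<and> q L2 < q L4)"
    by (intro notI; elim conjE; rule tie_layering.not_in_order_1234[OF swap23_tie]; simp)
  have reversed: "\<not> (q L4 < q L3 \<and> q L3 < q L2 \<and> q L2 < q L1)"
    by (intro notI; elim conjE; rule tie_layering.not_in_order_1234[OF reflection_tie]; simp)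
  have reversed': "\<not> (q L4 < q L2 \<and> q L2 < q L3 \<and> q L3 < q L1)"
    by (intro notI; elim conjE;
        rule tie_layering.not_in_order_1234[OF tie_layering.reflection_tie[OF swap23_tie]]; simp)
  have last: "(\<forall>p\<in>{L2, L3, L1}. q L4 < q p) \<or> (\<forall>p\<in>{L2, L3, L1}. q p < q L4)"
    using tie_layering.blob1_at_end[OF swap14_tie] by simp
  have "q L2 \<noteq> q L3" by (rule q_inj) (simp_all add: blobs_def)
  then consider "q L2 < q L3" | "q L3 < q L2" by linarith
  then show False
    using blob1_at_end last order order' reversed reversed' by cases auto
qed

end

section \<open>Covers of a path\<close>

definition simple_path :: "('v, 'e, 'm) metric_graph_scheme \<Rightarrow> 'v list \<Rightarrow> 'e list \<Rightarrow> bool" where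
  "simple_path T xs es \<longleftrightarrow> distinct xs \<and> set xs \<subseteq> verts T \<and> length xs = Suc (length es) \<and>
     (\<forall>i<length es. es ! i \<in> edges T \<and> endpoints T (es ! i) = {#xs ! i, xs ! Suc i#})"

lemma simple_path_snoc:
  assumes "simple_path T xs es" "e \<in> edges T" "endpoints T e = {#xs ! length es, y#}"
    "y \<in> verts T" "y \<notin> set xs"
  shows "simple_path T (xs @ [y]) (es @ [e])"
  using assms unfolding simple_path_def by (auto simp: nth_append less_Suc_eq)

lemma simple_path_Cons:
  assumes "simple_path T xs es" "e \<in> edges T" "endpoints T e = {#xs ! 0, y#}"
    "y \<in> verts T" "y \<notin> set xs"
  shows "simple_path T (y # xs) (e # es)"
  using assms unfolding simple_path_def
  by (auto simp: nth_Cons add_mset_commute split: nat.splits)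

lemma simple_path_distinct_edges:
  assumes "simple_path T xs es" shows "distinct es"
  unfolding distinct_conv_nth
proof (intro allI impI)
  fix i j assume ij: "i < length es" "j < length es" "i \<noteq> j"
  have "distinct xs" "length xs = Suc (length es)" using assms unfolding simple_path_def by auto
  then have "xs ! a = xs ! b \<longleftrightarrow> a = b" if "a \<le> length es" "b \<le> length es" for a b
    using that by (simp add: nth_eq_iff_index_eq)
  then have "{#xs ! i, xs ! Suc i#} \<noteq> {#xs ! j, xs ! Suc j#}"
    using ij by (auto simp: mset_pair_eq)
  then show "es ! i \<noteq> es ! j" using assms ij unfolding simple_path_def by metis
qed

text \<open>The number of vertices bounds the length.\<close>

lemma longest_simple_path:
  assumes "metric_graph T"
  obtains xs es where "simple_path T xs es"
    "\<And>xs' es'. simple_path T xs' es' \<Longrightarrow> length es' \<le> length es"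
proof -
  obtain v where "v \<in> verts T" using assms unfolding metric_graph_def by blast
  then have "simple_path T [v] []" by (simp add: simple_path_def)
  moreover have "length es \<le> card (verts T)" if "simple_path T xs es" for xs es
  proof -
    have "length xs = card (set xs)" using that distinct_card unfolding simple_path_def by metis
    also have "\<dots> \<le> card (verts T)"
      using that assms unfolding simple_path_def metric_graph_def by (intro card_mono) auto
    finally show ?thesis using that unfolding simple_path_def by simp
  qed
  ultimately have "\<exists>p. (case p of (xs, es) \<Rightarrow> simple_path T xs es) \<and>
      (\<forall>p'. (case p' of (xs, es) \<Rightarrow> simple_path T xs es) \<longrightarrow> length (snd p') \<le> length (snd p))"
    by (intro ex_has_greatest_nat[of _ "([v], [])" "\<lambda>p. length (snd p)" "Suc (card (verts T))"])
      (auto simp: less_Suc_eq_le)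
  then show thesis using that by force
qed

text \<open>Take a longest simple path. A bounded edge outside it cannot be attached to an interior vertex, whose two
  directions are used up; attached to an end it would prolong the path, or close it to a cycle.
  So no bounded edge leaves the path, which by connectedness is everything.\<close>

lemma path_graph_listing:
  assumes T: "path_graph T"
  obtains xs es where "simple_path T xs es" "set xs = verts T"
    "\<And>e. e \<in> edges T \<Longrightarrow> size (endpoints T e) = 2 \<Longrightarrow> e \<in> set es"
proof -
  have M: "metric_graph T" and conn: "connected_graph T" and acyc: "\<not> has_cycle T"
    and val: "\<And>v. v \<in> verts T \<Longrightarrow> valence T v \<le> 2"
    using T unfolding path_graph_def metric_tree_def by auto
  obtain xs es where P: "simple_path T xs es"
    and max: "\<And>xs' es'. simple_path T xs' es' \<Longrightarrow> length es' \<le> length es"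
    using longest_simple_path[OF M] by blast
  define n where "n = length es"
  have xs: "distinct xs" "set xs \<subseteq> verts T" "length xs = Suc n"
    and es: "\<And>i. i < n \<Longrightarrow> es ! i \<in> edges T" "\<And>i. i < n \<Longrightarrow> endpoints T (es ! i) = {#xs ! i, xs ! Suc i#}"
    using P unfolding simple_path_def n_def by auto
  have des: "distinct es" by (rule simple_path_distinct_edges[OF P])
  have sub: "set es \<subseteq> edges T" using es(1) unfolding n_def by (metis in_set_conv_nth subsetI)
  \<comment> \<open>The edges of the path use up \<open>card {j. \<dots>}\<close> of the two directions at its \<open>i\<close>-th vertex.\<close>
  have room: "count (endpoints T e) (xs ! i) + card {j. j < n \<and> (i = j \<or> i = Suc j)} \<le> 2"
    if e: "e \<in> edges T" "e \<notin> set es" and i: "i \<le> n" for e i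
  proof -
    let ?J = "{j. j < n \<and> (i = j \<or> i = Suc j)}"
    have "card ?J = (\<Sum>j\<in>?J. 1)" by simp
    also have "\<dots> \<le> (\<Sum>j\<in>?J. count (endpoints T (es ! j)) (xs ! i))"
      by (rule sum_mono) (use es(2) in auto)
    also have "\<dots> = deg_in T ((!) es ` ?J) (xs ! i)"
    proof -
      have "inj_on ((!) es) ?J" using des by (auto simp: inj_on_def n_def nth_eq_iff_index_eq)
      then show ?thesis unfolding deg_in_def by (simp add: sum.reindex)
    qed
    also have "\<dots> \<le> deg_in T (set es) (xs ! i)"
      by (rule deg_in_mono) (auto simp: n_def)
    finally have "count (endpoints T e) (xs ! i) + card ?J \<le> deg_in T (insert e (set es)) (xs ! i)"
      using deg_in_insert[of "set es" e T "xs ! i"] e by simp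
    also have "\<dots> \<le> valence T (xs ! i)"
      by (rule deg_in_le_valence[OF M]) (use e sub in simp)
    also have "\<dots> \<le> 2" using val xs i by (metis le_imp_less_Suc nth_mem subsetD)
    finally show ?thesis .
  qed
  have at_end: "i = 0 \<or> i = n" if e: "e \<in> edges T" "e \<notin> set es" "xs ! i \<in># endpoints T e" and i: "i \<le> n" for e i
  proof (rule ccontr)
    assume "\<not> (i = 0 \<or> i = n)"
    then have "{j. j < n \<and> (i = j \<or> i = Suc j)} = {i, i - 1}" "i \<noteq> i - 1" using i by auto
    then have "card {j. j < n \<and> (i = j \<or> i = Suc j)} = 2" by simp
    moreover have "0 < count (endpoints T e) (xs ! i)" using e(3) by simp
    ultimately show False using room[OF e(1,2) i] by linarith
  qed
  have touch: "e \<in> set es" if e: "e \<in> edges T" "endpoints T e = {#x, y#}" "x \<in> set xs" for e x y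
  proof (rule ccontr)
    assume no: "e \<notin> set es"
    obtain i where i: "i \<le> n" "x = xs ! i" using e(3) xs(3) by (metis in_set_conv_nth less_Suc_eq_le)
    have i': "i = 0 \<or> i = n" by (rule at_end[OF e(1) no _ i(1)]) (use e i in simp)
    have yV: "y \<in> verts T" using endpoints_verts[OF M e(1), of y] e(2) by simp
    have "y \<in> set xs"
    proof (rule ccontr)
      assume y: "y \<notin> set xs"
      have "\<exists>xs' es'. simple_path T xs' es' \<and> length es' = Suc n"
        using i'
      proof
        assume "i = n"
        then show ?thesis using simple_path_snoc[OF P e(1) _ yV y] e(2) i n_def by (metis length_append_singleton)
      next
        assume "i = 0"
        then show ?thesis using simple_path_Cons[OF P e(1) _ yV y] e(2) i n_def by (metis length_Cons)
      qed
      then show False using max n_def by (metis Suc_n_not_le_n)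
    qed
    then obtain j where j: "j \<le> n" "y = xs ! j" using xs(3) by (metis in_set_conv_nth less_Suc_eq_le)
    have j': "j = 0 \<or> j = n" by (rule at_end[OF e(1) no _ j(1)]) (use e j in simp)
    \<comment> \<open>Also covers \<open>n = 0\<close>, where the edge is a loop and closes a cycle of length one.\<close>
    have "endpoints T e = {#xs ! n, xs ! 0#}"
    proof (cases "i = j")
      case True
      have "n = 0"
      proof (rule ccontr)
        assume "n \<noteq> 0"
        then have "(if i = 0 then 0 else i - 1) \<in> {j. j < n \<and> (i = j \<or> i = Suc j)}" using i' by auto
        then have "0 < card {j. j < n \<and> (i = j \<or> i = Suc j)}" by (subst card_gt_0_iff) auto
        moreover have "count (endpoints T e) (xs ! i) = 2" using e(2) i j True by simp
        ultimately show False using room[OF e(1) no i(1)] by simp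
      qed
      then show ?thesis using e(2) i j by simp
    next
      case False
      then show ?thesis using e(2) i j i' j' by (auto simp: add_mset_commute)
    qed
    then have "endpoints T ((es @ [e]) ! i) = {#xs ! i, xs ! (Suc i mod Suc n)#}" if "i < Suc n" for i
      using that es(2)[of i] mod_less[of "Suc i" "Suc n"]
      by (cases "i = n") (simp_all add: nth_append n_def)
    then have "is_cycle T xs (es @ [e])"
      unfolding is_cycle_def using xs des no sub e(1) n_def by simp
    then show False using acyc unfolding has_cycle_def by blast
  qed
  have all: "set xs = verts T"
  proof (rule ccontr)
    assume "set xs \<noteq> verts T"
    then obtain x y where xy: "x \<in> set xs" "y \<in> verts T - set xs" "adj T x y"
      using cut_connectedE[OF cut_connected_connected_graph[OF M conn], of "set xs"] xs by force
    then obtain e where e: "e \<in> edges T" "endpoints T e = {#x, y#}" unfolding adj_def by blast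
    then obtain i where "i < n" "e = es ! i" using touch xy(1) unfolding n_def by (metis in_set_conv_nth)
    then have "y \<in># {#xs ! i, xs ! Suc i#}" using es(2) e(2) by (metis add_mset_commute union_single_eq_member)
    then show False using xy(2) \<open>i < n\<close> xs(3) by auto
  qed
  show thesis
  proof (rule that[OF P all])
    fix e assume e: "e \<in> edges T" "size (endpoints T e) = 2"
    then obtain x y where "endpoints T e = {#x, y#}" by (auto simp: size2_iff)
    then show "e \<in> set es" using touch[OF e(1)] endpoints_verts[OF M e(1), of x] all by simp
  qed
qed

text \<open>The coordinate that a listing of the vertices along a path provides. The last two clauses express
  that no height is skipped: the edge towards a higher or lower vertex exists.\<close>

definition height :: "('v, 'e, 'm) metric_graph_scheme \<Rightarrow> ('v \<Rightarrow> int) \<Rightarrow> bool" where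
  "height T h \<longleftrightarrow> inj_on h (verts T) \<and>
     (\<forall>e\<in>edges T. \<forall>x y. endpoints T e = {#x, y#} \<longrightarrow> \<bar>h x - h y\<bar> = 1) \<and>
     (\<forall>e\<in>edges T. \<forall>f\<in>edges T. size (endpoints T e) = 2 \<and> endpoints T e = endpoints T f \<longrightarrow> e = f) \<and>
     (\<forall>x\<in>verts T. \<forall>y\<in>verts T. h x < h y \<longrightarrow> (\<exists>e\<in>edges T. \<exists>z\<in>verts T. endpoints T e = {#x, z#} \<and> h z = h x + 1)) \<and>
     (\<forall>x\<in>verts T. \<forall>y\<in>verts T. h y < h x \<longrightarrow> (\<exists>e\<in>edges T. \<exists>z\<in>verts T. endpoints T e = {#x, z#} \<and> h z = h x - 1))"

lemma path_graph_height:
  assumes T: "path_graph T"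
  obtains h where "height T h"
proof -
  obtain xs es where P: "simple_path T xs es" and V: "set xs = verts T"
    and E: "\<And>e. e \<in> edges T \<Longrightarrow> size (endpoints T e) = 2 \<Longrightarrow> e \<in> set es"
    using path_graph_listing[OF T] by blast
  define n where "n = length es"
  have xs: "distinct xs" "length xs = Suc n"
    and es: "\<And>i. i < n \<Longrightarrow> es ! i \<in> edges T" "\<And>i. i < n \<Longrightarrow> endpoints T (es ! i) = {#xs ! i, xs ! Suc i#}"
    using P unfolding simple_path_def n_def by auto
  have des: "distinct es" by (rule simple_path_distinct_edges[OF P])
  define h where "h v = int (THE i. i \<le> n \<and> xs ! i = v)" for v
  have h: "h (xs ! i) = int i" if "i \<le> n" for i
  proof -
    have "(THE j. j \<le> n \<and> xs ! j = xs ! i) = i"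
      by (rule the_equality) (use that xs in \<open>auto simp: nth_eq_iff_index_eq\<close>)
    then show ?thesis by (simp add: h_def)
  qed
  have idx: "\<exists>i\<le>n. v = xs ! i" if "v \<in> verts T" for v
    using that V xs(2) by (metis in_set_conv_nth less_Suc_eq_le)
  have edge: "\<exists>i<n. e = es ! i" if "e \<in> edges T" "size (endpoints T e) = 2" for e
    using E[OF that] unfolding n_def by (metis in_set_conv_nth)
  have mem: "xs ! i \<in> verts T" if "i \<le> n" for i using that V xs(2) by (metis le_imp_less_Suc nth_mem)
  have "height T h"
    unfolding height_def
  proof (intro conjI ballI allI impI)
    show "inj_on h (verts T)"
    proof (rule inj_onI)
      fix v w assume "v \<in> verts T" "w \<in> verts T" "h v = h w"
      moreover from this obtain i j where "i \<le> n" "v = xs ! i" "j \<le> n" "w = xs ! j" using idx by meson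
      ultimately show "v = w" using h by simp
    qed
  next
    fix e x y assume e: "e \<in> edges T" "endpoints T e = {#x, y#}"
    then obtain i where i: "i < n" "e = es ! i" using edge[of e] by auto
    then have "{#x, y#} = {#xs ! i, xs ! Suc i#}" using es(2) e(2) by metis
    then have "x = xs ! i \<and> y = xs ! Suc i \<or> x = xs ! Suc i \<and> y = xs ! i" unfolding mset_pair_eq .
    then show "\<bar>h x - h y\<bar> = 1" using h[of i] h[of "Suc i"] i(1) by auto
  next
    fix e f assume ef: "e \<in> edges T" "f \<in> edges T" "size (endpoints T e) = 2 \<and> endpoints T e = endpoints T f"
    then obtain i j where ij: "i < n" "e = es ! i" "j < n" "f = es ! j" using edge[of e] edge[of f] by auto
    then have "{#xs ! i, xs ! Suc i#} = {#xs ! j, xs ! Suc j#}" using es(2) ef(3) by metis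
    then have "i = j"
      using ij(1,3) xs by (auto simp: mset_pair_eq nth_eq_iff_index_eq)
    then show "e = f" using ij by simp
  next
    fix x y assume xy: "x \<in> verts T" "y \<in> verts T" "h x < h y"
    then obtain i j where ij: "i \<le> n" "x = xs ! i" "j \<le> n" "y = xs ! j" using idx by meson
    then have "i < n" using xy(3) h by simp
    then show "\<exists>e\<in>edges T. \<exists>z\<in>verts T. endpoints T e = {#x, z#} \<and> h z = h x + 1"
      using es[of i] ij h[of i] h[of "Suc i"] mem[of "Suc i"]
      by (intro bexI[of _ "es ! i"] bexI[of _ "xs ! Suc i"]) auto
  next
    fix x y assume xy: "x \<in> verts T" "y \<in> verts T" "h y < h x"
    then obtain i j where ij: "i \<le> n" "x = xs ! i" "j \<le> n" "y = xs ! j" using idx by meson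
    then obtain k where k: "i = Suc k" using xy(3) h by (cases i) auto
    then show "\<exists>e\<in>edges T. \<exists>z\<in>verts T. endpoints T e = {#x, z#} \<and> h z = h x - 1"
      using es[of k] ij h[of k] h[of "Suc k"] mem[of k]
      by (intro bexI[of _ "es ! k"] bexI[of _ "xs ! k"]) (auto simp: add_mset_commute)
  qed
  then show thesis by (rule that)
qed

text \<open>The height of a vertex is that of its image, and the climbing edges \<open>U\<close> are the bounded edges that are
  not contracted: in a direction in which the target continues to a further vertex, its edge is
  bounded, and so is every edge above it. The last conclusion is where non-degeneracy enters:
  contracted bounded edges are not loops.\<close>

lemma path_cover_layering:
  fixes G :: "('v, 'e, 'm) metric_graph_scheme" and T :: "('w, 'f, 'n) metric_graph_scheme"
  assumes cov: "well_contracted_cover G T \<phi> 3"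
    and h: "height T h"
  obtains U lo hi where
    "layering (verts G) (\<lambda>v. h (vmap \<phi> v)) U lo hi (slope \<phi>) (local_degree G T \<phi>)"
    "U \<subseteq> edges G"
    "\<And>e. e \<in> U \<Longrightarrow> endpoints G e = {#lo e, hi e#}"
    "\<And>e. e \<in> U \<Longrightarrow> 0 < slope \<phi> e"
    "\<And>e x y. \<lbrakk>e \<in> edges G; endpoints G e = {#x, y#}; e \<notin> U\<rbrakk> \<Longrightarrow> x \<noteq> y \<and> vmap \<phi> x = vmap \<phi> y"
proof -
  have mor: "graph_morphism G T \<phi>" and harm: "harmonic G T \<phi>" and deg: "has_degree G T \<phi> 3"
    and nd: "non_degenerate G \<phi>"
    using cov unfolding well_contracted_cover_def tropical_cover_def by auto
  have G: "metric_graph G" and T: "metric_graph T"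
    and loopless: "\<And>e' t. e' \<in> edges T \<Longrightarrow> endpoints T e' \<noteq> {#t, t#}"
    and vT: "\<And>v. v \<in> verts G \<Longrightarrow> vmap \<phi> v \<in> verts T"
    using mor unfolding graph_morphism_def by auto
  have over: "e' \<in> edges T \<and> endpoints T e' = image_mset (vmap \<phi>) (endpoints G e) \<and> 0 < slope \<phi> e"
    if "e \<in> edges G" "emap \<phi> e = Inr e'" for e e'
    using mor that unfolding graph_morphism_def by force
  have contracted: "slope \<phi> e = 0 \<and> (\<forall>v\<in>#endpoints G e. vmap \<phi> v = v')" if "e \<in> edges G" "emap \<phi> e = Inl v'" for e v'
    using mor that unfolding graph_morphism_def by force
  have finG: "finite (edges G)" "finite (verts G)" using G unfolding metric_graph_def by auto
  note VG = endpoints_verts[OF G]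
  let ?m = "local_degree G T \<phi>"
  have m: "slope_sum G \<phi> v e' = ?m v" if "v \<in> verts G" "e' \<in> edges T" "vmap \<phi> v \<in># endpoints T e'" for v e'
  proof -
    let ?e = "SOME e'. e' \<in> edges T \<and> vmap \<phi> v \<in># endpoints T e'"
    have "?e \<in> edges T \<and> vmap \<phi> v \<in># endpoints T ?e" by (rule someI[of _ e']) (use that in blast)
    then show ?thesis using harm that unfolding harmonic_def local_degree_def by blast
  qed
  have incident: "\<exists>e e'. e \<in> edges G \<and> v \<in># endpoints G e \<and> emap \<phi> e = Inr e' \<and> 0 < slope \<phi> e \<and>
      e' \<in> edges T \<and> vmap \<phi> v \<in># endpoints T e'" if v: "v \<in> verts G" for v
  proof -
    obtain e where e: "e \<in> edges G" "v \<in># endpoints G e" "0 < slope \<phi> e"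
      using nd v unfolding non_degenerate_def by blast
    then obtain e' where e': "emap \<phi> e = Inr e'" using contracted[OF e(1)] by (cases "emap \<phi> e") auto
    then show ?thesis using over[OF e(1) e'] e by auto
  qed
  have m_pos: "0 < ?m v" if v: "v \<in> verts G" for v
  proof -
    obtain e e' where e: "e \<in> edges G" "v \<in># endpoints G e" "emap \<phi> e = Inr e'" "0 < slope \<phi> e"
      "e' \<in> edges T" "vmap \<phi> v \<in># endpoints T e'" using incident[OF v] by blast
    have "slope \<phi> e \<le> slope_sum G \<phi> v e'"
      unfolding slope_sum_def by (rule member_le_sum) (use e finG in auto)
    then show ?thesis using m[OF v e(5,6)] e(4) by simp
  qed
  \<comment> \<open>As targets have no loops, an edge has at most one end above a given vertex, so a fibre's multiplicities add up to the degree.\<close>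
  have one_end: "x = y" if e: "e \<in> edges G" "emap \<phi> e = Inr e'"
    and xy: "x \<in># endpoints G e" "y \<in># endpoints G e" "vmap \<phi> x = vmap \<phi> y" for e e' x y
  proof (rule ccontr)
    assume "x \<noteq> y"
    obtain M where M: "endpoints G e = add_mset x M" using xy(1) by (metis multi_member_split)
    then have "y \<in># M" using xy(2) \<open>x \<noteq> y\<close> by simp
    then obtain N where N: "M = add_mset y N" by (metis multi_member_split)
    have "size (endpoints G e) \<le> 2" by (rule size_endpoints_le[OF G e(1)])
    then have "endpoints G e = {#x, y#}" using M N by simp
    then show False using over[OF e] loopless xy(3) by auto
  qed
  have fibre: "(\<Sum>v | v \<in> verts G \<and> vmap \<phi> v = t. ?m v) \<le> 3" for t
  proof (cases "\<exists>v\<in>verts G. vmap \<phi> v = t")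
    case True
    then obtain e' where e': "e' \<in> edges T" "t \<in># endpoints T e'" using incident by metis
    let ?A = "{v. v \<in> verts G \<and> vmap \<phi> v = t}"
    let ?E = "\<lambda>v. {e \<in> edges G. v \<in># endpoints G e \<and> emap \<phi> e = Inr e'}"
    have "(\<Sum>v\<in>?A. ?m v) = (\<Sum>v\<in>?A. sum (slope \<phi>) (?E v))"
      by (intro sum.cong refl) (use m e' in \<open>auto simp: slope_sum_def\<close>)
    also have "\<dots> = sum (slope \<phi>) (\<Union>v\<in>?A. ?E v)"
      by (rule sum.UNION_disjoint[symmetric]) (use finG one_end in auto)
    also have "\<dots> \<le> (\<Sum>e \<in> {e \<in> edges G. emap \<phi> e = Inr e'}. slope \<phi> e)"
      by (rule sum_mono2) (use finG in auto)
    also have "\<dots> = 3" using deg e'(1) unfolding has_degree_def by blast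
    finally show ?thesis .
  next
    case False
    then have "{v. v \<in> verts G \<and> vmap \<phi> v = t} = {}" by blast
    then show ?thesis by (metis (no_types, lifting) sum.empty zero_le)
  qed
  define U where "U = {e \<in> edges G. (\<exists>e'. emap \<phi> e = Inr e') \<and> size (endpoints G e) = 2}"
  let ?h = "\<lambda>v. h (vmap \<phi> v)"
  have h_step: "\<bar>h x - h y\<bar> = 1" if "e \<in> edges T" "endpoints T e = {#x, y#}" for e x y
    using h that unfolding height_def by blast
  have h_inj: "x = y" if "x \<in> verts T" "y \<in> verts T" "h x = h y" for x y
    using h that unfolding height_def inj_on_def by blast
  have h_unique: "e = f" if "e \<in> edges T" "f \<in> edges T" "size (endpoints T e) = 2" "endpoints T e = endpoints T f" for e f
    using h that unfolding height_def by blast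
  have "\<exists>p. endpoints G e = {#fst p, snd p#} \<and> ?h (snd p) = ?h (fst p) + 1" if e: "e \<in> U" for e
  proof -
    have "size (endpoints G e) = 2" using e unfolding U_def by blast
    then obtain x y where xy: "endpoints G e = {#x, y#}" unfolding size2_iff by blast
    obtain e' where "e \<in> edges G" "emap \<phi> e = Inr e'" using e unfolding U_def by blast
    from over[OF this] have "\<bar>?h x - ?h y\<bar> = 1" using h_step[of e' "vmap \<phi> x" "vmap \<phi> y"] xy by auto
    then have "?h y = ?h x + 1 \<or> ?h x = ?h y + 1" by linarith
    then show ?thesis
    proof
      assume "?h y = ?h x + 1"
      then show ?thesis using xy by (intro exI[of _ "(x, y)"]) simp
    next
      assume "?h x = ?h y + 1"
      then show ?thesis using xy by (intro exI[of _ "(y, x)"]) (simp add: add_mset_commute)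
    qed
  qed
  then obtain p where p: "\<And>e. e \<in> U \<Longrightarrow> endpoints G e = {#fst (p e), snd (p e)#} \<and> ?h (snd (p e)) = ?h (fst (p e)) + 1"
    by metis
  define lo hi where "lo e = fst (p e)" and "hi e = snd (p e)" for e
  have ends: "endpoints G e = {#lo e, hi e#}" and step: "?h (hi e) = ?h (lo e) + 1" if "e \<in> U" for e
    using p[OF that] by (auto simp: lo_def hi_def)
  have UE: "e \<in> edges G" if "e \<in> U" for e using that unfolding U_def by blast
  have lohi: "lo e \<in> verts G" "hi e \<in> verts G" if "e \<in> U" for e
    using VG[OF UE[OF that]] ends[OF that] by auto
  have pushed: "\<exists>e'. emap \<phi> e = Inr e' \<and> e' \<in> edges T \<and> endpoints T e' = {#vmap \<phi> (lo e), vmap \<phi> (hi e)#}"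
    if e: "e \<in> U" for e
  proof -
    obtain e' where "emap \<phi> e = Inr e'" using e unfolding U_def by blast
    then show ?thesis using over[OF UE[OF e]] ends[OF e] by auto
  qed
  have inU: "e \<in> U" if "e \<in> edges G" "emap \<phi> e = Inr e'" "endpoints T e' = {#t, z#}" for e e' t z
  proof -
    have "image_mset (vmap \<phi>) (endpoints G e) = {#t, z#}" using over[OF that(1,2)] that(3) by simp
    then have "size (image_mset (vmap \<phi>) (endpoints G e)) = 2" by (simp only:) simp
    then show ?thesis using that unfolding U_def by simp
  qed
  have up: "(\<Sum>e | e \<in> U \<and> lo e = v. slope \<phi> e) = ?m v"
    if v: "v \<in> verts G" and u: "u \<in> verts G" "?h v < ?h u" for u v
  proof -
    obtain e' z where e': "e' \<in> edges T" "z \<in> verts T" "endpoints T e' = {#vmap \<phi> v, z#}" "h z = ?h v + 1"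
      using h vT[OF v] vT[OF u(1)] u(2) unfolding height_def by blast
    have "{e. e \<in> U \<and> lo e = v} = {e \<in> edges G. v \<in># endpoints G e \<and> emap \<phi> e = Inr e'}"
    proof (intro set_eqI iffI)
      fix e assume "e \<in> {e. e \<in> U \<and> lo e = v}"
      then have e: "e \<in> U" "lo e = v" by auto
      obtain e'' where e'': "emap \<phi> e = Inr e''" "e'' \<in> edges T" "endpoints T e'' = {#vmap \<phi> v, vmap \<phi> (hi e)#}"
        using pushed[OF e(1)] e(2) by auto
      have "vmap \<phi> (hi e) = z"
        by (rule h_inj) (use vT lohi[OF e(1)] e' step[OF e(1)] e(2) in auto)
      then have "e'' = e'" using h_unique[OF e''(2) e'(1)] e'' e' by simp
      then show "e \<in> {e \<in> edges G. v \<in># endpoints G e \<and> emap \<phi> e = Inr e'}"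
        using e e'' ends[OF e(1)] UE by auto
    next
      fix e assume "e \<in> {e \<in> edges G. v \<in># endpoints G e \<and> emap \<phi> e = Inr e'}"
      then have e: "e \<in> edges G" "v \<in># endpoints G e" "emap \<phi> e = Inr e'" by auto
      have eU: "e \<in> U" by (rule inU[OF e(1,3) e'(3)])
      have "{#vmap \<phi> (lo e), vmap \<phi> (hi e)#} = {#vmap \<phi> v, z#}" using pushed[OF eU] e(3) e'(3) by auto
      then have "vmap \<phi> (lo e) = z \<or> vmap \<phi> (hi e) = z" by (auto simp: mset_pair_eq)
      then have "v \<noteq> hi e" using step[OF eU] e'(4) by auto
      then show "e \<in> {e. e \<in> U \<and> lo e = v}" using e(2) ends[OF eU] eU by auto
    qed
    then show ?thesis using m[OF v e'(1)] e'(3) unfolding slope_sum_def by simp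
  qed
  have down: "(\<Sum>e | e \<in> U \<and> hi e = v. slope \<phi> e) = ?m v"
    if v: "v \<in> verts G" and u: "u \<in> verts G" "?h u < ?h v" for u v
  proof -
    obtain e' z where e': "e' \<in> edges T" "z \<in> verts T" "endpoints T e' = {#vmap \<phi> v, z#}" "h z = ?h v - 1"
      using h vT[OF v] vT[OF u(1)] u(2) unfolding height_def by blast
    have "{e. e \<in> U \<and> hi e = v} = {e \<in> edges G. v \<in># endpoints G e \<and> emap \<phi> e = Inr e'}"
    proof (intro set_eqI iffI)
      fix e assume "e \<in> {e. e \<in> U \<and> hi e = v}"
      then have e: "e \<in> U" "hi e = v" by auto
      obtain e'' where e'': "emap \<phi> e = Inr e''" "e'' \<in> edges T" "endpoints T e'' = {#vmap \<phi> (lo e), vmap \<phi> v#}"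
        using pushed[OF e(1)] e(2) by auto
      have "vmap \<phi> (lo e) = z"
        by (rule h_inj) (use vT lohi[OF e(1)] e' step[OF e(1)] e(2) in auto)
      then have "e'' = e'" using h_unique[OF e''(2) e'(1)] e'' e' by (simp add: add_mset_commute)
      then show "e \<in> {e \<in> edges G. v \<in># endpoints G e \<and> emap \<phi> e = Inr e'}"
        using e e'' ends[OF e(1)] UE by auto
    next
      fix e assume "e \<in> {e \<in> edges G. v \<in># endpoints G e \<and> emap \<phi> e = Inr e'}"
      then have e: "e \<in> edges G" "v \<in># endpoints G e" "emap \<phi> e = Inr e'" by auto
      have eU: "e \<in> U" by (rule inU[OF e(1,3) e'(3)])
      have "{#vmap \<phi> (lo e), vmap \<phi> (hi e)#} = {#vmap \<phi> v, z#}" using pushed[OF eU] e(3) e'(3) by auto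
      then have "vmap \<phi> (lo e) = z \<or> vmap \<phi> (hi e) = z" by (auto simp: mset_pair_eq)
      then have "v \<noteq> lo e" using step[OF eU] e'(4) by auto
      then show "e \<in> {e. e \<in> U \<and> hi e = v}" using e(2) ends[OF eU] eU by auto
    qed
    then show ?thesis using m[OF v e'(1)] e'(3) unfolding slope_sum_def by simp
  qed
  show thesis
  proof (rule that[of U lo hi])
    show "layering (verts G) ?h U lo hi (slope \<phi>) ?m"
    proof
      show "(\<Sum>v | v \<in> verts G \<and> ?h v = k. ?m v) \<le> 3" for k
      proof (cases "\<exists>t\<in>verts T. h t = k")
        case True
        then obtain t where t: "t \<in> verts T" "h t = k" by blast
        have "{v. v \<in> verts G \<and> ?h v = k} = {v. v \<in> verts G \<and> vmap \<phi> v = t}"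
          using vT h_inj t by auto
        then show ?thesis using fibre[of t] by simp
      next
        case False
        then have "{v. v \<in> verts G \<and> ?h v = k} = {}" using vT by blast
        then show ?thesis by (metis (no_types, lifting) sum.empty zero_le)
      qed
      show "finite U" using finG unfolding U_def by simp
    qed (use finG lohi step up down m_pos in auto)
    show "x \<noteq> y \<and> vmap \<phi> x = vmap \<phi> y" if e: "e \<in> edges G" "endpoints G e = {#x, y#}" "e \<notin> U" for e x y
    proof -
      obtain v' where v': "emap \<phi> e = Inl v'" using e unfolding U_def by (cases "emap \<phi> e") auto
      have "x \<noteq> y"
      proof
        assume "x = y"
        then show False using nd e(1,2) v' unfolding non_degenerate_def by blast
      qed
      then show ?thesis using contracted[OF e(1) v'] e(2) by auto
    qed
    show "0 < slope \<phi> e" if "e \<in> U" for e using over UE that unfolding U_def by blast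
  qed (use UE ends in auto)
qed

text \<open>Look at a vertex \<open>v\<close> of \<open>F\<close> of maximal height. If a contracted edge of \<open>F\<close> ends there, its two ends are
  different vertices of the same fibre. Otherwise all edges of \<open>F\<close> at \<open>v\<close> arrive from below, and there
  are at least two of them because \<open>F\<close> is leafless.\<close>

lemma leafless_heavy:
  assumes L: "layering (verts G) h U lo hi s m" and G: "metric_graph G"
    and U: "U \<subseteq> edges G" "\<And>e. e \<in> U \<Longrightarrow> endpoints G e = {#lo e, hi e#}" "\<And>e. e \<in> U \<Longrightarrow> 0 < s e"
    and contracted: "\<And>e x y. \<lbrakk>e \<in> edges G; endpoints G e = {#x, y#}; e \<notin> U\<rbrakk> \<Longrightarrow> x \<noteq> y \<and> h x = h y"
    and F: "leafless G F" "\<And>e v. e \<in> F \<Longrightarrow> v \<in># endpoints G e \<Longrightarrow> v \<in> X"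
  shows "\<exists>k. 2 \<le> layering.weight (verts G) h m X k"
proof -
  interpret layering "verts G" h U lo hi s m by (rule L)
  note VG = endpoints_verts[OF G]
  have FE: "F \<subseteq> edges G" "F \<noteq> {}" "\<And>e. e \<in> F \<Longrightarrow> size (endpoints G e) = 2" "\<And>v. deg_in G F v \<noteq> 1"
    using F unfolding leafless_def by auto
  have finF: "finite F" using FE(1) finite_edges[OF G] finite_subset by blast
  define A where "A = (\<Union>e\<in>F. set_mset (endpoints G e))"
  have A: "finite A" "A \<subseteq> verts G" "A \<subseteq> X" using finF VG FE(1) F(2) unfolding A_def by auto
  obtain e where e: "e \<in> F" using FE(2) by blast
  then obtain x y where "endpoints G e = {#x, y#}" using FE(3) unfolding size2_iff by blast
  then have "x \<in> A" unfolding A_def using e by force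
  then have "h ` A \<noteq> {}" "finite (h ` A)" using A(1) by auto
  then have "Max (h ` A) \<in> h ` A" by (metis Max_in)
  then obtain v where v: "v \<in> A" "h v = Max (h ` A)" by (metis imageE)
  have top: "h u \<le> h v" if "u \<in> A" for u using v(2) A(1) that by simp
  have vV: "v \<in> verts G" "v \<in> X" using v A by auto
  show ?thesis
  proof (cases "\<exists>e\<in>F. v \<in># endpoints G e \<and> e \<notin> U")
    case True
    then obtain e where e: "e \<in> F" "v \<in># endpoints G e" "e \<notin> U" by blast
    obtain x y where xy: "endpoints G e = {#x, y#}" using FE(3)[OF e(1)] unfolding size2_iff by blast
    then have ne: "x \<noteq> y" "h x = h y" using contracted[OF _ xy e(3)] e(1) FE(1) by auto
    have "x \<in> verts G" "y \<in> verts G" using VG[of e] e(1) FE(1) xy by auto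
    moreover have "{x} \<union> {y} \<subseteq> X" using F(2)[OF e(1)] xy by auto
    ultimately have "2 \<le> weight X (h x)"
      using weight_mono[of "{x} \<union> {y}" X "h x"] weight_Un[of "{x}" "{y}" "h x"] ne
        weight_pos[of x "{x}"] weight_pos[of y "{y}"] by simp
    then show ?thesis by blast
  next
    case False
    have hi: "e \<in> U \<and> hi e = v \<and> count (endpoints G e) v = 1" if "e \<in> F" "v \<in># endpoints G e" for e
    proof -
      have eU: "e \<in> U" using False that by blast
      then have "hi e \<in> A" using U(2) that(1) unfolding A_def by force
      then have "v \<noteq> lo e" using top[of "hi e"] h_hi[OF eU] by auto
      then show ?thesis using that(2) U(2)[OF eU] eU by auto
    qed
    let ?F = "{e\<in>F. v \<in># endpoints G e}"
    obtain e where e: "e \<in> F" "v \<in># endpoints G e" using v(1) unfolding A_def by blast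
    then have lower: "h (lo e) < h v" "lo e \<in> verts G" using hi[OF e] h_hi lo_in by auto
    have "deg_in G F v = (\<Sum>e\<in>?F. count (endpoints G e) v)"
      unfolding deg_in_def by (rule sum.mono_neutral_right) (use finF in \<open>auto simp: not_in_iff\<close>)
    also have "\<dots> = (\<Sum>e\<in>?F. 1)" by (rule sum.cong) (use hi in auto)
    also have "\<dots> \<le> (\<Sum>e\<in>?F. s e)"
      by (rule sum_mono) (use hi U(3) in \<open>auto simp: Suc_le_eq\<close>)
    also have "\<dots> \<le> (\<Sum>e | e \<in> U \<and> hi e = v. s e)"
      by (rule sum_mono2) (use finite_U hi in auto)
    also have "\<dots> = m v" by (rule down_sum[OF vV(1) lower(2,1)])
    also have "\<dots> \<le> weight X (h v)"
      unfolding weight_def by (rule member_le_sum) (use vV finite_V in auto)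
    finally have "deg_in G F v \<le> weight X (h v)" .
    moreover have "deg_in G F v \<noteq> 0" using deg_in_zero_iff[OF finF, of G v] e by blast
    ultimately have "2 \<le> weight X (h v)" using FE(4)[of v] by linarith
    then show ?thesis by blast
  qed
qed

lemma tie_partition_no_cover:
  assumes c: "tie_partition G c" and cov: "well_contracted_cover G T \<phi> 3"
  shows False
proof -
  have "path_graph T" and G: "metric_graph G"
    using cov unfolding well_contracted_cover_def tropical_cover_def graph_morphism_def by auto
  then obtain h where h: "height T h" using path_graph_height by blast
  let ?h = "\<lambda>v. h (vmap \<phi> v)" and ?m = "local_degree G T \<phi>"
  obtain U lo hi where L: "layering (verts G) ?h U lo hi (slope \<phi>) ?m"
    and U: "U \<subseteq> edges G" "\<And>e. e \<in> U \<Longrightarrow> endpoints G e = {#lo e, hi e#}" "\<And>e. e \<in> U \<Longrightarrow> 0 < slope \<phi> e"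
    and con: "\<And>e x y. \<lbrakk>e \<in> edges G; endpoints G e = {#x, y#}; e \<notin> U\<rbrakk> \<Longrightarrow> x \<noteq> y \<and> vmap \<phi> x = vmap \<phi> y"
    using path_cover_layering[OF cov h] by metis
  interpret layering "verts G" ?h U lo hi "slope \<phi>" ?m by (rule L)
  have "\<exists>k. 2 \<le> weight {v. c v = p} k" if p: "p \<in> blobs" for p
  proof -
    obtain F where F: "leafless G F" "\<And>e v. e \<in> F \<Longrightarrow> v \<in># endpoints G e \<Longrightarrow> c v = p"
      using c p unfolding tie_partition_def by blast
    show ?thesis
    proof (rule leafless_heavy[OF L G U _ F(1)])
      show "x \<noteq> y \<and> ?h x = ?h y" if "e \<in> edges G" "endpoints G e = {#x, y#}" "e \<notin> U" for e x y
        using con[OF that] by simp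
      show "v \<in> {v. c v = p}" if "e \<in> F" "v \<in># endpoints G e" for e v
        using F(2)[OF that] by simp
    qed
  qed
  then obtain q where q: "\<And>p. p \<in> blobs \<Longrightarrow> 2 \<le> weight {v. c v = p} (q p)" by metis
  have im: "image_mset c (endpoints G e) = {#c (lo e), c (hi e)#}" if "e \<in> U" for e
    using U(2)[OF that] by simp
  have uniq: "\<exists>!e. e \<in> edges G \<and> image_mset c (endpoints G e) = M" if "M \<in> joined" for M
    using c that unfolding tie_partition_def by blast
  have cross: "{#c (lo e), c (hi e)#} \<in> joined" if "e \<in> U" "c (lo e) \<noteq> c (hi e)" for e
    using c U(1) U(2)[OF that(1)] that unfolding tie_partition_def by blast
  have "tie_layering (verts G) ?h U lo hi (slope \<phi>) ?m (adj G) c q"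
  proof
    show "\<bar>?h x - ?h y\<bar> \<le> 1" if xy: "adj G x y" for x y
    proof -
      obtain e where e: "e \<in> edges G" "endpoints G e = {#x, y#}" using xy unfolding adj_def by blast
      show ?thesis
      proof (cases "e \<in> U")
        case True
        then have "x = lo e \<and> y = hi e \<or> x = hi e \<and> y = lo e" using U(2)[OF True] e(2) by (simp add: mset_pair_eq)
        then show ?thesis using h_hi[OF True] by auto
      next
        case False
        then show ?thesis using con[OF e] by simp
      qed
    qed
    show "cut_connected (adj G) {v \<in> verts G. c v = p}" for p
      using c unfolding tie_partition_def by blast
    show "\<exists>x\<in>verts G. \<exists>y\<in>verts G. c x = p \<and> c y = p' \<and> adj G x y" if J: "{#p, p'#} \<in> joined" for p p'
    proof -
      obtain e where e: "e \<in> edges G" "image_mset c (endpoints G e) = {#p, p'#}" using uniq[OF J] by blast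
      then obtain x y where xy: "endpoints G e = {#x, y#}" "c x = p" "c y = p'" by (metis image_mset_pair)
      then have "x \<in> verts G" "y \<in> verts G" using endpoints_verts[OF G e(1)] by auto
      then show ?thesis using xy e(1) unfolding adj_def by blast
    qed
    show "e = f" if "e \<in> U" "f \<in> U" "c (lo e) \<noteq> c (hi e)" "{#c (lo e), c (hi e)#} = {#c (lo f), c (hi f)#}" for e f
      using uniq[OF cross[OF that(1,3)]] im that U(1) by (metis subsetD)
  qed (use symp_adj cross q in auto)
  then show False by (rule tie_layering.no_tie_layering)
qed

section \<open>The theorem\<close>

theorem lemma5p4:
  fixes \<Gamma> C :: "('v, 'e) tropical_curve"
    and \<Gamma>' :: "('w, 'f) metric_graph"
  assumes "tropical_curve \<Gamma>"
    and "canonical_model \<Gamma> C"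
    and "tie_fighter C"
    and "tropical_modification \<Gamma>' \<Gamma>"
  shows "\<not> admits_well_contracted_cover \<Gamma>' 3"
proof
  assume "admits_well_contracted_cover \<Gamma>' 3"
  then obtain G1 T :: "(nat, nat) metric_graph" and \<phi> where
    same: "same_metric_graph G1 \<Gamma>'" and cov: "well_contracted_cover G1 T \<phi> 3"
    unfolding admits_well_contracted_cover_def by blast
  obtain C' and C0 :: "('v, 'e) tropical_curve" where
    C': "canonical_model \<Gamma>' C'" and C0: "canonical_model \<Gamma> C0" "same_metric_graph C' C0"
    using assms(4) unfolding tropical_modification_def by blast
  have \<Gamma>: "metric_graph \<Gamma>" using assms(1) unfolding tropical_curve_def by blast
  have "has_tie_partition C" using assms(3) by (rule tie_fighter_has_tie_partition)
  then have "has_tie_partition \<Gamma>" using has_tie_partition_canonical_model[OF assms(2) \<Gamma>] by simp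
  then have "has_tie_partition C0" using has_tie_partition_canonical_model[OF C0(1) \<Gamma>] by simp
  then have "has_tie_partition C'" using has_tie_partition_same[OF C0(2)] by simp
  then have "has_tie_partition \<Gamma>'"
    using has_tie_partition_canonical_model[OF C'] has_tie_partition_same(2)[OF same] by simp
  then have "has_tie_partition G1" using has_tie_partition_same(3)[OF same] by simp
  then show False using tie_partition_no_cover[OF _ cov] unfolding has_tie_partition_def by blast
qed

end
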